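(* Let $I\subset\mathbb{R}$ be a compact interval and let $f:I\to I$ be a topologically mixing $C^2$ map. Assume that there is a return time function $R:J\to\mathbb{N}\cup\{\infty\}$, whose base set $J\subset I$ is a compact interval, satisfying conditions (H1)–(H4) listed in the context. Then $$\dim_H(I\setminus QR(f))=1,$$ where $QR(f)$ is the set of quasi-regular points for $f$.
   Context: Topological mixing: $f:I\to I$ is called topologically mixing if for every nontrivial interval $L\subset I$, $f^k(L)=I$ holds for all sufficiently large $k\ge1$. Quasi-regular points: a point $x\in I$ is quasi-regular for $f$ if the sequence of empirical distributions $\delta_x^n:=\frac1n(\delta_x+\delta_{f(x)}+\cdots+\delta_{f^{n-1}(x)})$ ($\delta_y$ being the Dirac measure at $y$) converges in the weak* topology, as $n\to\infty$, to an $f$-invariant Borel probability measure on $I$. $QR(f)$ is the set of all quasi-regular points. Notation: $\dim_H$ is Hausdorff dimension; $|A|$ is the length of an interval $A$; $m$ is Lebesgue measure. Return time function: a function $R:J\to\mathbb{N}\cup\{\infty\}$ with base set $J\subset I$ is a return time function if $f^{R(x)}(x)\in J$ whenever $x\in J$ and $R(x)<\infty$ ($R$ need not be the first return time to $J$). The conditions are: (H1) There is a constant $\lambda>1$ such that for any $n\ge1$, if $V$ is a connected component of $\{x\in J:R(x)=n\}$, then $f^nV=J$ and $|(f^n)'(x)|\ge\lambda$ for all $x\in V$. (H2) There is a sequence $\{\varepsilon_k\}_{k=0}^\infty$ of positive numbers converging to zero such that for any $n\ge1$, if $A$ is a connected component of $$\{x\in J:R(x)=k_1,\ R(f^{k_1}(x))=k_2,\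 \ldots,\ R(f^{k_1+\cdots+k_{l-2}}(x))=k_{l-1},\ R(f^{k_1+\cdots+k_{l-1}}(x))\ge k_l\}$$ for some integers $k_1,\ldots,k_l\ge1$ with $k_1+\cdots+k_l=n$, then $|f^i(A)|\le\varepsilon_{n-i}$ for all $0\le i\le n-1$. (H3) There are a constant $C\ge1$ and a sequence $\{\eta_k\}_{k=0}^\infty$ of positive numbers converging to zero such that for any $n\ge1$, if $B$ is a connected component of $$\{x\in J:R(x)=k_1,\ R(f^{k_1}(x))=k_2,\ \ldots,\ R(f^{k_1+\cdots+k_{l-1}}(x))=k_l\}$$ for some integers $k_1,\ldots,k_l\ge1$ with $k_1+\cdots+k_l=n$, then $$\frac{|(f^n)'(y)|}{|(f^n)'(z)|}\le C\quad\text{and}\quad\frac{|(f^{k_1})'(y)|}{|(f^{k_1})'(z)|}\le e^{\eta_l}\qquad\text{for all }y,z\in B.$$ (H4) There are an integer $l_0\ge1$ and a constant $\gamma_0>0$ such that for any $n\ge1$, if $U$ is a connected component of $\{x\in J:R(x)>n\}$, then $m(\{x\in U:R(x)\le n+l_0\})\ge\gamma_0\,m(U)$. *)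

theory Defs
  imports "HOL-Probability.Probability"
begin

section \<open>Hausdorff dimension\<close>

text \<open>The case split implements the conventions $0^0 = 1$ for nonempty sets and weight $0$ for
  the empty set; note that \<open>0 powr 0 = 0\<close> in HOL.\<close>

definition hausdorff_weight :: "real \<Rightarrow> 'a::metric_space set \<Rightarrow> ennreal" where
  "hausdorff_weight s U =
     (if U = {} then 0 else if s = 0 then 1 else ennreal (diameter U powr s))"

text \<open>Boundedness is required explicitly because \<open>diameter\<close> is only meaningful on
  bounded sets.\<close>

definition hausdorff_premeasure :: "real \<Rightarrow> real \<Rightarrow> 'a::metric_space set \<Rightarrow> ennreal" where
  "hausdorff_premeasure s \<delta> A =
     (INF U \<in> {U :: nat \<Rightarrow> 'a set. A \<subseteq> (\<Union>i. U i) \<and> (\<forall>i. bounded (U i) \<and> diameter (U i) \<le> \<delta>)}.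
        \<Sum>i. hausdorff_weight s (U i))"

definition hausdorff_outer_measure :: "real \<Rightarrow> 'a::metric_space set \<Rightarrow> ennreal" where
  "hausdorff_outer_measure s A = (SUP \<delta>\<in>{0<..}. hausdorff_premeasure s \<delta> A)"

definition hausdorff_dim :: "'a::metric_space set \<Rightarrow> ennreal" where
  "hausdorff_dim A = Inf {ennreal s | s. 0 \<le> s \<and> hausdorff_outer_measure s A = 0}"


section \<open>Interval maps\<close>

text \<open>All derivatives are taken within the phase interval, hence one-sided at its end points.\<close>

definition C2_on :: "real set \<Rightarrow> (real \<Rightarrow> real) \<Rightarrow> bool" where
  "C2_on I f \<longleftrightarrow> (\<exists>f' f''.
     (\<forall>x\<in>I. (f has_real_derivative f' x) (at x within I)) \<and>
     (\<forall>x\<in>I. (f' has_real_derivative f'' x) (at x within I)) \<and>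
     continuous_on I f'')"

abbreviation iter_deriv :: "real set \<Rightarrow> (real \<Rightarrow> real) \<Rightarrow> nat \<Rightarrow> real \<Rightarrow> real" where
  "iter_deriv I f n x \<equiv> vector_derivative (f ^^ n) (at x within I)"

definition topologically_mixing_on :: "real set \<Rightarrow> (real \<Rightarrow> real) \<Rightarrow> bool" where
  "topologically_mixing_on I f \<longleftrightarrow>
     (\<forall>L. is_interval L \<and> L \<subseteq> I \<and> (\<exists>x\<in>L. \<exists>y\<in>L. x \<noteq> y) \<longrightarrow>
        (\<forall>\<^sub>F k in sequentially. (f ^^ k) ` L = I))"


section \<open>Quasi-regular points\<close>

text \<open>The average of the point masses at \<open>x, f x, \<dots>, (f ^^ (n - 1)) x\<close>, as a Borel
  measure on \<open>I\<close>; see the lemma \<open>emeasure_empirical_measure\<close> below.\<close>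

definition empirical_measure ::
  "real set \<Rightarrow> (real \<Rightarrow> real) \<Rightarrow> nat \<Rightarrow> real \<Rightarrow> real measure" where
  "empirical_measure I f n x =
     distr (uniform_count_measure {..<n}) (restrict_space borel I) (\<lambda>i. (f ^^ i) x)"

definition weak_star_converges ::
  "real set \<Rightarrow> (nat \<Rightarrow> real measure) \<Rightarrow> real measure \<Rightarrow> bool" where
  "weak_star_converges I M \<mu> \<longleftrightarrow>
     (\<forall>\<phi>. continuous_on I \<phi> \<longrightarrow>
        (\<lambda>n. \<integral>x. (\<phi> x :: real) \<partial>M n) \<longlonglongrightarrow> (\<integral>x. \<phi> x \<partial>\<mu>))"

definition invariant_borel_prob :: "real set \<Rightarrow> (real \<Rightarrow> real) \<Rightarrow> real measure \<Rightarrow> bool" where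
  "invariant_borel_prob I f \<mu> \<longleftrightarrow>
     prob_space \<mu> \<and> space \<mu> = I \<and> sets \<mu> = sets (restrict_space borel I) \<and>
     f \<in> measurable \<mu> \<mu> \<and> distr \<mu> \<mu> f = \<mu>"

definition quasi_regular :: "real set \<Rightarrow> (real \<Rightarrow> real) \<Rightarrow> real set" where
  "quasi_regular I f =
     {x \<in> I. \<exists>\<mu>. invariant_borel_prob I f \<mu> \<and>
        weak_star_converges I (\<lambda>n. empirical_measure I f n x) \<mu>}"

lemma funpow_in:
  assumes "f ` I \<subseteq> I" "x \<in> I"
  shows "(f ^^ i) x \<in> I"
  using assms by (induction i) auto

lemma measurable_orbit:
  fixes f :: "real \<Rightarrow> real"
  assumes "f ` I \<subseteq> I" "x \<in> I"
  shows "(\<lambda>i. (f ^^ i) x) \<in> measurable (uniform_count_measure {..<n}) (restrict_space borel I)"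
  using funpow_in[OF assms]
  by (auto simp: measurable_def space_uniform_count_measure sets_uniform_count_measure space_restrict_space)

lemma emeasure_empirical_measure:
  fixes f :: "real \<Rightarrow> real"
  assumes "f ` I \<subseteq> I" "x \<in> I" "n \<ge> 1" "A \<in> sets (restrict_space borel I)"
  shows "emeasure (empirical_measure I f n x) A =
           ennreal ((1 / real n) * (\<Sum>i<n. indicat_real A ((f ^^ i) x)))"
proof -
  have "emeasure (empirical_measure I f n x) A =
          emeasure (uniform_count_measure {..<n}) ((\<lambda>i. (f ^^ i) x) -` A \<inter> {..<n})"
    unfolding empirical_measure_def
    using assms measurable_orbit[of f I x n]
    by (subst emeasure_distr) (simp_all add: space_uniform_count_measure)
  also have "\<dots> = ennreal (real (card ((\<lambda>i. (f ^^ i) x) -` A \<inter> {..<n})) / real n)"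
    by (simp add: emeasure_uniform_count_measure)
  also have "real (card ((\<lambda>i. (f ^^ i) x) -` A \<inter> {..<n})) = (\<Sum>i<n. indicat_real A ((f ^^ i) x))"
    by (simp add: indicator_def vimage_def Int_commute)
  finally show ?thesis by simp
qed

lemma integral_empirical_measure:
  fixes f \<phi> :: "real \<Rightarrow> real"
  assumes "f ` I \<subseteq> I" "x \<in> I" "continuous_on I \<phi>"
  shows "(\<integral>y. \<phi> y \<partial>empirical_measure I f n x) = (\<Sum>i<n. \<phi> ((f ^^ i) x)) / real n"
  unfolding empirical_measure_def
  using assms measurable_orbit[of f I x n]
  by (subst integral_distr)
    (auto simp: integral_uniform_count_measure intro: borel_measurable_continuous_on_restrict)


section \<open>Return time functions\<close>

text \<open>Only the values of \<open>R\<close> on \<open>J\<close> matter. Return times are positive; without this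
  requirement the constant function \<open>R = 0\<close> would satisfy all conditions below vacuously.\<close>

definition return_time_function :: "(real \<Rightarrow> real) \<Rightarrow> real set \<Rightarrow> (real \<Rightarrow> enat) \<Rightarrow> bool" where
  "return_time_function f J R \<longleftrightarrow>
     (\<forall>x\<in>J. R x \<noteq> 0) \<and> (\<forall>x\<in>J. \<forall>n. R x = enat n \<longrightarrow> (f ^^ n) x \<in> J)"

definition return_cylinder ::
  "(real \<Rightarrow> real) \<Rightarrow> real set \<Rightarrow> (real \<Rightarrow> enat) \<Rightarrow> nat list \<Rightarrow> real set" where
  "return_cylinder f J R ks =
     {x \<in> J. \<forall>j<length ks. R ((f ^^ sum_list (take j ks)) x) = enat (ks ! j)}"

definition return_cylinder_ge ::
  "(real \<Rightarrow> real) \<Rightarrow> real set \<Rightarrow> (real \<Rightarrow> enat) \<Rightarrow> nat list \<Rightarrow> real set" where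
  "return_cylinder_ge f J R ks =
     {x \<in> return_cylinder f J R (butlast ks).
        R ((f ^^ sum_list (butlast ks)) x) \<ge> enat (last ks)}"

definition return_composition :: "nat \<Rightarrow> nat list \<Rightarrow> bool" where
  "return_composition n ks \<longleftrightarrow> ks \<noteq> [] \<and> (\<forall>k\<in>set ks. k \<ge> 1) \<and> sum_list ks = n"

definition cond_H1 ::
  "real set \<Rightarrow> (real \<Rightarrow> real) \<Rightarrow> real set \<Rightarrow> (real \<Rightarrow> enat) \<Rightarrow> bool" where
  "cond_H1 I f J R \<longleftrightarrow>
     (\<exists>\<Lambda>>1. \<forall>n\<ge>1. \<forall>V \<in> components {x \<in> J. R x = enat n}.
        (f ^^ n) ` V = J \<and> (\<forall>x\<in>V. \<bar>iter_deriv I f n x\<bar> \<ge> \<Lambda>))"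

definition cond_H2 ::
  "(real \<Rightarrow> real) \<Rightarrow> real set \<Rightarrow> (real \<Rightarrow> enat) \<Rightarrow> bool" where
  "cond_H2 f J R \<longleftrightarrow>
     (\<exists>\<epsilon> :: nat \<Rightarrow> real. (\<forall>k. \<epsilon> k > 0) \<and> \<epsilon> \<longlonglongrightarrow> 0 \<and>
        (\<forall>n\<ge>1. \<forall>ks. return_composition n ks \<longrightarrow>
           (\<forall>A \<in> components (return_cylinder_ge f J R ks).
              \<forall>i\<le>n - 1. measure lebesgue ((f ^^ i) ` A) \<le> \<epsilon> (n - i))))"

definition cond_H3 ::
  "real set \<Rightarrow> (real \<Rightarrow> real) \<Rightarrow> real set \<Rightarrow> (real \<Rightarrow> enat) \<Rightarrow> bool" where
  "cond_H3 I f J R \<longleftrightarrow>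
     (\<exists>C\<ge>1. \<exists>\<eta> :: nat \<Rightarrow> real. (\<forall>k. \<eta> k > 0) \<and> \<eta> \<longlonglongrightarrow> 0 \<and>
        (\<forall>n\<ge>1. \<forall>ks. return_composition n ks \<longrightarrow>
           (\<forall>B \<in> components (return_cylinder f J R ks). \<forall>y\<in>B. \<forall>z\<in>B.
              \<bar>iter_deriv I f n y\<bar> / \<bar>iter_deriv I f n z\<bar> \<le> C \<and>
              \<bar>iter_deriv I f (hd ks) y\<bar> / \<bar>iter_deriv I f (hd ks) z\<bar> \<le> exp (\<eta> (length ks)))))"

definition cond_H4 :: "real set \<Rightarrow> (real \<Rightarrow> enat) \<Rightarrow> bool" where
  "cond_H4 J R \<longleftrightarrow>
     (\<exists>l0\<ge>1. \<exists>\<gamma>>0. \<forall>n\<ge>1. \<forall>U \<in> components {x \<in> J. R x > enat n}.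
        measure lebesgue {x \<in> U. R x \<le> enat (n + l0)} \<ge> \<gamma> * measure lebesgue U)"

end

theory Submission
  imports Defs "HOL-Real_Asymp.Real_Asymp"
begin

text \<open>The branches, that is the components of the sets \<open>{R = n}\<close>, are compact intervals mapped onto \<open>J\<close>
  by expanding diffeomorphisms with uniformly bounded distortion (H1, H3), and by H4 finitely many of
  them fill \<open>J\<close> up to an arbitrarily small proportion. Consider the points of \<open>J\<close> whose itinerary is an
  arbitrary sequence of such branches, except that in the positions \<open>q ^ (k + 1), \<dots>, q ^ (k + 1) + q ^ k - 1\<close>
  the branch \<open>u\<close> (for even \<open>k\<close>) or \<open>v\<close> (for odd \<open>k\<close>) is prescribed. Each of these runs takes a fixed
  proportion of the elapsed time, so convergent Birkhoff averages would have to agree with the averages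
  over the periodic orbits of the fixed points of both \<open>u\<close> and \<open>v\<close>. There are infinitely many branches, so
  \<open>u\<close> and \<open>v\<close> can be chosen such that these two orbits are disjoint; then no such point is quasi-regular.
  At a free position a cylinder loses only a small proportion of its length, and for large \<open>q\<close> the
  prescribed positions have small density, so that the dimension of this set is arbitrarily close to 1.\<close>

section \<open>Content of limit sets of trees\<close>

text \<open>The constants have to be fixed in an order that avoids a circle. Forcing
  \<open>u\<close> or \<open>v\<close> costs a cylinder a factor that may be tiny, but it depends
  only on \<open>u\<close>, \<open>v\<close>, \<open>J\<close> and the distortion constant. It is
  therefore known before \<open>q\<close> is chosen, and a large \<open>q\<close> makes forced
  positions rare enough to pay for it. What may be lost is measured against the expansion: a
  cylinder of level n has length at most \<open>(d - c) / \<Lambda> ^ n\<close>, so for an exponent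
  \<open>s < 1\<close> the accumulated loss up to level n may be as large as
  \<open>\<Lambda> powr ((1 - s) * n)\<close>. Half of this exponent is granted to the free
  positions, half to the forced ones. The alphabet is kept finite for two reasons: distinct branches
  then have a positive distance, so that a ball meeting two children of a cylinder is comparable in
  size with it; and return times are bounded, so that proportions of digits become proportions of
  time. Neither measurability of \<open>R\<close> nor closedness of its level sets is assumed.
  Expansion and fullness of the branches supply both: inverse branches are continuous on the compact
  interval \<open>J\<close>, and each level set has finitely many components.\<close>

definition words :: "(nat \<Rightarrow> 's set) \<Rightarrow> nat \<Rightarrow> 's list set" where
  "words A n = {xs. length xs = n \<and> (\<forall>j<n. xs ! j \<in> A j)}"

lemma words_0 [simp]: "words A 0 = {[]}"
  by (auto simp: words_def)

lemma words_Suc: "words A (Suc n) = (\<lambda>(xs, s). xs @ [s]) ` (words A n \<times> A n)"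
proof (intro equalityI subsetI)
  fix zs assume zs: "zs \<in> words A (Suc n)"
  then obtain xs s where eq: "zs = xs @ [s]" "length xs = n"
    unfolding words_def by (cases zs rule: rev_cases) auto
  have "xs ! j \<in> A j" if "j < n" for j
    using zs that eq unfolding words_def by (auto simp: nth_append dest!: spec[of _ j])
  moreover have "s \<in> A n"
    using zs eq unfolding words_def by (auto dest!: spec[of _ n])
  ultimately show "zs \<in> (\<lambda>(xs, s). xs @ [s]) ` (words A n \<times> A n)"
    using eq by (auto simp: words_def)
qed (auto simp: words_def nth_append less_Suc_eq)

lemma words_snoc: "xs \<in> words A n \<Longrightarrow> s \<in> A n \<Longrightarrow> xs @ [s] \<in> words A (Suc n)"
  by (auto simp: words_Suc)

lemma finite_words: "(\<And>n. finite (A n)) \<Longrightarrow> finite (words A n)"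
  by (induction n) (auto simp: words_Suc)

lemma words_subset:
  assumes "xs \<in> words A m" "\<And>j. A j \<subseteq> S"
  shows "set xs \<subseteq> S"
proof
  fix x assume "x \<in> set xs"
  then obtain j where "j < m" "x = xs ! j" using assms(1) by (auto simp: words_def in_set_conv_nth)
  then show "x \<in> S" using assms by (auto simp: words_def)
qed

lemma words_append:
  assumes "zs \<in> words A (n + m)"
  obtains xs ys where "zs = xs @ ys" "xs \<in> words A n" "length ys = m" "\<forall>j<m. ys ! j \<in> A (n + j)"
proof
  show "zs = take n zs @ drop n zs" by simp
  show "take n zs \<in> words A n" "length (drop n zs) = m" "\<forall>j<m. drop n zs ! j \<in> A (n + j)"
    using assms by (auto simp: words_def)
qed

text \<open>Built from levels rather than infinite sequences: for finite alphabets and compact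
  \<open>B xs\<close>, each level is compact. The alphabet \<open>A j\<close> depends on the
  position, so a digit is prescribed by a singleton.\<close>

definition tree_limit :: "('s list \<Rightarrow> 'a set) \<Rightarrow> (nat \<Rightarrow> 's set) \<Rightarrow> 'a set" where
  "tree_limit B A = (\<Inter>n. \<Union>xs\<in>words A n. B xs)"

lemma tree_limitE:
  assumes "x \<in> tree_limit B A"
  obtains xs where "xs \<in> words A n" "x \<in> B xs"
  using assms by (auto simp: tree_limit_def)

text \<open>The levels are nested compact sets whose intersection lies in the open union, so some
  level already lies in it. This reduces a countable cover to finitely many sets that cover all deep
  cylinders.\<close>

lemma tree_limit_finite_subcover:
  fixes B :: "'s list \<Rightarrow> 'a::euclidean_space set"
  assumes fin: "\<And>n. finite (A n)"
    and comp: "\<And>n xs. xs \<in> words A n \<Longrightarrow> compact (B xs)"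
    and sub: "\<And>n xs s. xs \<in> words A n \<Longrightarrow> s \<in> A n \<Longrightarrow> B (xs @ [s]) \<subseteq> B xs"
    and op: "\<And>i. open (W i)" and cover: "tree_limit B A \<subseteq> (\<Union>i. W i)"
  obtains N T where "finite T" "\<And>m xs. m \<ge> N \<Longrightarrow> xs \<in> words A m \<Longrightarrow> B xs \<subseteq> (\<Union>i\<in>T. W i)"
proof -
  define L where "L n = (\<Union>xs\<in>words A n. B xs)" for n
  define O' where "O' = (\<Union>i. W i)"
  have Lc: "compact (L n)" for n
    unfolding L_def using comp finite_words[OF fin] by (intro compact_UN) auto
  have "L (Suc n) \<subseteq> L n" for n
    unfolding L_def words_Suc using sub by fastforce
  then have Lmono: "m \<le> n \<Longrightarrow> L n \<subseteq> L m" for m n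
    by (rule lift_Suc_antimono_le)
  have "\<exists>N. L N \<subseteq> O'"
  proof (rule ccontr)
    assume "\<not> ?thesis"
    then have "L n - O' \<noteq> {}" for n by auto
    moreover have "compact (L n - O')" for n
      using Lc op unfolding O'_def by (intro compact_diff) auto
    ultimately have "\<Inter>(range (\<lambda>n. L n - O')) \<noteq> {}"
      using Lmono by (intro compact_nest) blast+
    then show False
      using cover unfolding tree_limit_def O'_def L_def by auto
  qed
  then obtain N where N: "L N \<subseteq> O'" by blast
  obtain T where T: "finite T" "L N \<subseteq> (\<Union>i\<in>T. W i)"
    using compactE_image[OF Lc[of N], of UNIV W] N op unfolding O'_def by auto
  show ?thesis
  proof (rule that[OF T(1)])
    fix m xs assume "N \<le> m" "xs \<in> words A m"
    then show "B xs \<subseteq> (\<Union>i\<in>T. W i)"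
      using Lmono[of N m] T(2) unfolding L_def by blast
  qed
qed

text \<open>A mass distribution principle without a measure: the function \<open>K n * len xs\<close> plays the role
  of the mass of the cylinder \<open>B xs\<close> of level \<open>n\<close>, and the estimate is carried from a deep level of
  the tree back to its root.\<close>

lemma tree_limit_content:
  fixes B :: "'s list \<Rightarrow> real set" and len :: "'s list \<Rightarrow> real" and K :: "nat \<Rightarrow> real"
  assumes fin: "\<And>n. finite (A n)"
    and comp: "\<And>n xs. xs \<in> words A n \<Longrightarrow> compact (B xs)"
    and ne: "\<And>n xs. xs \<in> words A n \<Longrightarrow> B xs \<noteq> {}"
    and sub: "\<And>n xs s. xs \<in> words A n \<Longrightarrow> s \<in> A n \<Longrightarrow> B (xs @ [s]) \<subseteq> B xs"
    and len_pos: "\<And>n xs. xs \<in> words A n \<Longrightarrow> len xs > 0"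
    and len_le: "\<And>n xs. xs \<in> words A n \<Longrightarrow> len xs \<le> L / \<Lambda> ^ n"
    and sep: "\<And>n xs s t x y. xs \<in> words A n \<Longrightarrow> s \<in> A n \<Longrightarrow> t \<in> A n \<Longrightarrow> s \<noteq> t \<Longrightarrow>
        x \<in> B (xs @ [s]) \<Longrightarrow> y \<in> B (xs @ [t]) \<Longrightarrow> g * len xs \<le> \<bar>x - y\<bar>"
    and mass: "\<And>n xs. xs \<in> words A n \<Longrightarrow> K n * len xs \<le> K (Suc n) * (\<Sum>s\<in>A n. len (xs @ [s]))"
    and K: "\<And>n. 0 \<le> K n" "\<And>n. K n \<le> \<Lambda> powr ((1 - s) * real n)" "0 < K 0"
    and const: "1 < \<Lambda>" "0 < g" "0 < L" "0 < s" "s < 1"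
  obtains c where "c > 0"
    "\<And>z r. (\<And>i::nat. 0 < r i) \<Longrightarrow> tree_limit B A \<subseteq> (\<Union>i. ball (z i) (r i)) \<Longrightarrow>
      \<exists>T. finite T \<and> c \<le> (\<Sum>i\<in>T. r i powr s)"
proof
  \<comment> \<open>The bounds on \<open>K n\<close> and \<open>len xs\<close> give
    \<open>K n * len xs powr (1 - s) \<le> L powr (1 - s)\<close>. With this \<open>c\<close> the
    scaled mass of a cylinder is thus at most the s-th power of half the gap between its
    children.\<close>
  define c where "c = (g / 2) powr s / L powr (1 - s)"
  have c: "c > 0" using const by (simp add: c_def)
  have len_powr: "c * K n * len xs \<le> (g / 2 * len xs) powr s" if xs: "xs \<in> words A n" for n xs
  proof -
    note lp = len_pos[OF xs]
    have "K n * len xs powr (1 - s) \<le> \<Lambda> powr ((1 - s) * real n) * (L / \<Lambda> ^ n) powr (1 - s)"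
      using K(2)[of n] len_le[OF xs] lp const by (intro mult_mono powr_mono2) auto
    also have "\<dots> = L powr (1 - s)"
      using const by (simp add: powr_divide powr_realpow[symmetric] powr_powr mult.commute)
    finally have "K n * len xs powr (1 - s) / L powr (1 - s) \<le> 1"
      using const by simp
    moreover have "c * K n * len xs = (g/2) powr s * len xs powr s * (K n * len xs powr (1 - s) / L powr (1 - s))"
      using lp by (simp add: c_def powr_diff)
    moreover have "(g / 2 * len xs) powr s = (g/2) powr s * len xs powr s"
      by (rule powr_mult)
    ultimately show ?thesis
      using mult_left_le[of "K n * len xs powr (1 - s) / L powr (1 - s)" "(g/2) powr s * len xs powr s"] by simp
  qed
  show "c * (K 0 * len []) > 0" using c K(3) len_pos[of "[]" 0] by simp
  fix z r assume r: "\<And>i::nat. 0 < r i" and cover: "tree_limit B A \<subseteq> (\<Union>i. ball (z i) (r i))"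
  obtain N T where T: "finite T" "\<And>m xs. m \<ge> N \<Longrightarrow> xs \<in> words A m \<Longrightarrow> B xs \<subseteq> (\<Union>i\<in>T. ball (z i) (r i))"
    by (rule tree_limit_finite_subcover[OF fin comp sub open_ball cover]) auto
  \<comment> \<open>The inserted 1 keeps \<open>Min\<close> meaningful when \<open>T\<close> is
    empty.\<close>
  have "\<exists>\<rho>>0. \<forall>i\<in>T. \<rho> \<le> r i powr s"
  proof (intro exI conjI ballI)
    show "0 < Min (insert 1 ((\<lambda>i. r i powr s) ` T))"
      using T(1) by (subst Min_gr_iff) (auto simp: less_imp_neq[OF r, symmetric])
    show "Min (insert 1 ((\<lambda>i. r i powr s) ` T)) \<le> r i powr s" if "i \<in> T" for i
      using that T(1) by (intro Min_le) auto
  qed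
  then obtain \<rho> where \<rho>: "\<rho> > 0" "\<And>i. i \<in> T \<Longrightarrow> \<rho> \<le> r i powr s" by blast
  \<comment> \<open>At level \<open>M\<close> every cylinder has less mass than the weight of any
    single ball of the finite subcover. One ball that meets it is then enough to start the backward
    induction.\<close>
  have "(\<lambda>n. (g / 2 * (L * (1 / \<Lambda>) ^ n)) powr s) \<longlonglongrightarrow> (g / 2 * (L * 0)) powr s"
    using const by (intro tendsto_powr2 tendsto_intros LIMSEQ_power_zero) (auto simp: )
  then have "eventually (\<lambda>n. (g / 2 * (L * (1 / \<Lambda>) ^ n)) powr s < \<rho>) sequentially"
    using \<rho>(1) by (intro order_tendstoD) auto
  then obtain M where M: "M \<ge> N" "(g / 2 * (L * (1 / \<Lambda>) ^ M)) powr s < \<rho>"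
    using eventually_happens'[OF sequentially_bot eventually_conj[OF eventually_ge_at_top[of N]]] by blast
  define hit where "hit xs = {i \<in> T. ball (z i) (r i) \<inter> B xs \<noteq> {}}" for xs
  have fhit: "finite (hit xs)" for xs using T(1) by (simp add: hit_def)
  have hit: "c * K n * len xs \<le> (\<Sum>i\<in>hit xs. r i powr s)" if "n \<le> M" "xs \<in> words A n" for n xs
    using that
  proof (induction n arbitrary: xs rule: inc_induct)
    case base
    have "B xs \<noteq> {}" "B xs \<subseteq> (\<Union>i\<in>T. ball (z i) (r i))"
      using ne[OF base] T(2)[OF M(1) base] by auto
    then obtain i where i: "i \<in> hit xs" by (fastforce simp: hit_def)
    have "c * K M * len xs \<le> (g / 2 * len xs) powr s" by (rule len_powr[OF base])
    also have "\<dots> \<le> (g / 2 * (L * (1 / \<Lambda>) ^ M)) powr s"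
    proof (rule powr_mono2)
      have "len xs \<le> L * (1 / \<Lambda>) ^ M" using len_le[OF base] by (simp add: power_one_over)
      then show "g / 2 * len xs \<le> g / 2 * (L * (1 / \<Lambda>) ^ M)" using const by simp
    qed (use len_pos[OF base] const in simp_all)
    also have "\<dots> \<le> r i powr s" using M(2) \<rho>(2)[of i] i by (simp add: hit_def)
    also have "\<dots> \<le> (\<Sum>i\<in>hit xs. r i powr s)" using i fhit by (intro member_le_sum) auto
    finally show ?case .
  next
    case (step n)
    note xs = step.prems
    \<comment> \<open>Either one ball meets two children, so that its radius is at least half their
      gap and it pays for the whole parent; or the balls hitting different children are different,
      and the estimates for the children add up.\<close>
    show ?case
    proof (cases "\<exists>i\<in>T. \<exists>s\<in>A n. \<exists>t\<in>A n. s \<noteq> t \<and> i \<in> hit (xs @ [s]) \<and> i \<in> hit (xs @ [t])")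
      case True
      then obtain i u t where i: "i \<in> T" "u \<in> A n" "t \<in> A n" "u \<noteq> t" "i \<in> hit (xs @ [u])" "i \<in> hit (xs @ [t])"
        by blast
      then obtain x y where xy: "x \<in> B (xs @ [u])" "dist (z i) x < r i" "y \<in> B (xs @ [t])" "dist (z i) y < r i"
        by (auto simp: hit_def)
      have "g * len xs \<le> \<bar>x - y\<bar>" using sep[OF xs i(2,3,4) xy(1,3)] .
      also have "\<dots> \<le> 2 * r i" using xy by (auto simp: dist_real_def)
      finally have "(g / 2 * len xs) powr s \<le> r i powr s"
        using len_pos[OF xs] const by (intro powr_mono2) auto
      then have "c * K n * len xs \<le> r i powr s" using len_powr[OF xs] by simp
      also have "i \<in> hit xs" using i sub[OF xs i(2)] by (auto simp: hit_def)
      then have "r i powr s \<le> (\<Sum>i\<in>hit xs. r i powr s)" using fhit by (intro member_le_sum) auto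
      finally show ?thesis .
    next
      case False
      have "c * K n * len xs \<le> c * (K (Suc n) * (\<Sum>s\<in>A n. len (xs @ [s])))"
        using mass[OF xs] c by simp
      also have "\<dots> = (\<Sum>s\<in>A n. c * K (Suc n) * len (xs @ [s]))"
        by (simp add: sum_distrib_left mult_ac)
      also have "\<dots> \<le> (\<Sum>t\<in>A n. \<Sum>i\<in>hit (xs @ [t]). r i powr s)"
        using step.IH words_snoc[OF xs] by (intro sum_mono) auto
      also have "\<dots> = (\<Sum>i\<in>(\<Union>t\<in>A n. hit (xs @ [t])). r i powr s)"
        using False fin fhit by (subst sum.UNION_disjoint) (auto simp: hit_def)
      also have "\<dots> \<le> (\<Sum>i\<in>hit xs. r i powr s)"
        using fhit sub[OF xs] by (intro sum_mono2) (fastforce simp: hit_def)+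
      finally show ?thesis .
    qed
  qed
  have "c * (K 0 * len []) \<le> (\<Sum>i\<in>hit []. r i powr s)"
    using hit[of 0 "[]"] by (simp add: mult_ac)
  then show "\<exists>T. finite T \<and> c * (K 0 * len []) \<le> (\<Sum>i\<in>T. r i powr s)"
    using fhit by blast
qed

section \<open>Bounds on the Hausdorff dimension\<close>

text \<open>Arbitrary covering sets are enlarged to open balls, the form needed for the compactness
  argument on trees. A bound by a finite partial sum is as good as one by the series.\<close>

lemma hausdorff_dim_ge_1:
  fixes A :: "real set"
  assumes content: "\<And>s. 0 < s \<Longrightarrow> s < 1 \<Longrightarrow> \<exists>c>0. \<forall>z r. (\<forall>i::nat. 0 < r i) \<longrightarrow> A \<subseteq> (\<Union>i. ball (z i) (r i)) \<longrightarrow>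
      (\<exists>T. finite T \<and> c \<le> (\<Sum>i\<in>T. r i powr s))"
  shows "hausdorff_dim A \<ge> 1"
  unfolding hausdorff_dim_def
proof (rule Inf_greatest, clarify)
  fix s :: real assume s: "0 \<le> s" "hausdorff_outer_measure s A = 0"
  show "1 \<le> ennreal s"
  proof (rule ccontr)
    assume "\<not> 1 \<le> ennreal s"
    then have "s < 1" by (metis ennreal_1 ennreal_leI linorder_not_le)
    \<comment> \<open>An exponent above \<open>s\<close> is positive even for \<open>s = 0\<close>,
      where the hypothesis says nothing. Sets of diameter at most 1 satisfy
      \<open>diameter U powr t \<le> diameter U powr s\<close>, so the premeasure at scale 1
      suffices.\<close>
    define t where "t = (s + 1) / 2"
    have t: "0 < t" "t < 1" "s \<le> t" using s \<open>s < 1\<close> by (auto simp: t_def)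
    obtain c where c: "c > 0" "\<And>z r. (\<And>i::nat. 0 < r i) \<Longrightarrow> A \<subseteq> (\<Union>i. ball (z i) (r i)) \<Longrightarrow>
        \<exists>T. finite T \<and> c \<le> (\<Sum>i\<in>T. r i powr t)"
      using content[OF t(1,2)] by blast
    have "hausdorff_premeasure s 1 A \<le> hausdorff_outer_measure s A"
      unfolding hausdorff_outer_measure_def by (rule SUP_upper) auto
    then have "hausdorff_premeasure s 1 A < ennreal (c / 2)"
      using s c by (simp add: ennreal_zero_less_divide)
    then obtain U where U: "A \<subseteq> (\<Union>i. U i)" "\<And>i. bounded (U i)" "\<And>i. diameter (U i) \<le> 1"
        "(\<Sum>i. hausdorff_weight s (U i)) < ennreal (c / 2)"
      unfolding hausdorff_premeasure_def INF_less_iff by auto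
    have weight: "ennreal (diameter (U i) powr t) \<le> hausdorff_weight s (U i)" for i
    proof (cases "s = 0 \<or> U i = {}")
      case True
      have "diameter (U i) powr t \<le> 1 powr t"
        using U(2,3)[of i] t by (intro powr_mono2 diameter_ge_0) auto
      then show ?thesis using True by (auto simp: hausdorff_weight_def)
    next
      case False
      then show ?thesis
        using U(2,3)[of i] t by (auto simp: hausdorff_weight_def intro!: ennreal_leI powr_mono' diameter_ge_0)
    qed
    \<comment> \<open>A radius strictly above the diameter lets any point of \<open>U i\<close>
      serve as centre and stays positive for singletons. The errors in the t-th powers sum to at
      most \<open>c / 2\<close>.\<close>
    have "\<exists>r. 0 < r \<and> diameter (U i) < r \<and> r powr t < diameter (U i) powr t + c / 2 * (1/2) ^ Suc i" for i
    proof -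
      have "0 \<le> diameter (U i)" using U(2)[of i] by (rule diameter_ge_0)
      then have "((\<lambda>\<rho>. (diameter (U i) + \<rho>) powr t) \<longlongrightarrow> (diameter (U i) + 0) powr t) (at_right 0)"
        using t by (intro tendsto_powr' tendsto_intros) (auto simp: eventually_at_filter)
      moreover have "(diameter (U i) + 0) powr t < diameter (U i) powr t + c / 2 * (1/2) ^ Suc i"
        using c by simp
      ultimately have "\<forall>\<^sub>F \<rho> in at_right 0. (diameter (U i) + \<rho>) powr t < diameter (U i) powr t + c / 2 * (1/2) ^ Suc i"
        by (rule order_tendstoD)
      then have "\<forall>\<^sub>F \<rho> in at_right 0. (diameter (U i) + \<rho>) powr t < diameter (U i) powr t + c / 2 * (1/2) ^ Suc i \<and> 0 < \<rho>"
        using eventually_at_right_less[of 0] by (rule eventually_conj)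
      then obtain \<rho> where "(diameter (U i) + \<rho>) powr t < diameter (U i) powr t + c / 2 * (1/2) ^ Suc i" "0 < \<rho>"
        using eventually_happens'[OF trivial_limit_at_right_real] by blast
      with \<open>0 \<le> diameter (U i)\<close> show ?thesis by (intro exI[of _ "diameter (U i) + \<rho>"]) auto
    qed
    then obtain r where r: "\<And>i. 0 < r i" "\<And>i. diameter (U i) < r i"
        "\<And>i. r i powr t < diameter (U i) powr t + c / 2 * (1/2) ^ Suc i" by metis
    have "A \<subseteq> (\<Union>i. ball (SOME z. z \<in> U i) (r i))"
    proof
      fix x assume "x \<in> A"
      then obtain i where i: "x \<in> U i" using U by auto
      then have "(SOME z. z \<in> U i) \<in> U i" by (rule someI)
      then have "dist (SOME z. z \<in> U i) x < r i"
        using diameter_bounded_bound[OF U(2)[of i] _ i] r(2)[of i] by fastforce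
      then show "x \<in> (\<Union>i. ball (SOME z. z \<in> U i) (r i))" by auto
    qed
    from c(2)[OF r(1) this] obtain T where T: "finite T" "c \<le> (\<Sum>i\<in>T. r i powr t)" by blast
    have "ennreal (\<Sum>i\<in>T. diameter (U i) powr t) = (\<Sum>i\<in>T. ennreal (diameter (U i) powr t))"
      by simp
    also have "\<dots> \<le> (\<Sum>i\<in>T. hausdorff_weight s (U i))" by (intro sum_mono weight)
    also have "\<dots> \<le> (\<Sum>i. hausdorff_weight s (U i))" using T by (intro sum_le_suminf) auto
    finally have "ennreal (\<Sum>i\<in>T. diameter (U i) powr t) < ennreal (c / 2)" using U(4) by simp
    then have "(\<Sum>i\<in>T. diameter (U i) powr t) < c / 2"
      by (subst (asm) ennreal_less_iff) (auto intro: sum_nonneg)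
    moreover have "(\<Sum>i\<in>T. (1/2::real) ^ Suc i) \<le> 1"
      using sum_le_suminf[OF sums_summable[OF power_half_series] T(1)] sums_unique[OF power_half_series]
      by simp
    then have "(\<Sum>i\<in>T. c / 2 * (1/2) ^ Suc i) \<le> c / 2"
      unfolding sum_distrib_left[symmetric] using mult_left_mono[of _ 1 "c / 2"] c(1) by simp
    moreover have "(\<Sum>i\<in>T. r i powr t) \<le> (\<Sum>i\<in>T. diameter (U i) powr t) + (\<Sum>i\<in>T. c / 2 * (1/2) ^ Suc i)"
      unfolding sum.distrib[symmetric] by (rule sum_mono) (rule less_imp_le[OF r(3)])
    ultimately show False using T(2) by linarith
  qed
qed

text \<open>Cutting into \<open>n + 1\<close> equal pieces gives total weight
  \<open>(b - a) powr s * (n + 1) powr (1 - s)\<close>, which tends to 0.\<close>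

lemma hausdorff_outer_measure_interval_eq_0:
  fixes a b s :: real
  assumes "A \<subseteq> {a..b}" "a \<le> b" "1 < s"
  shows "hausdorff_outer_measure s A = 0"
proof -
  have "hausdorff_premeasure s \<delta> A \<le> 0" if \<delta>: "\<delta> > 0" for \<delta>
  proof (rule ennreal_le_epsilon)
    fix e :: real assume e: "0 < e"
    have "(\<lambda>n. (b - a) / real (Suc n)) \<longlonglongrightarrow> 0"
      by real_asymp
    then have "\<forall>\<^sub>F n in sequentially. (b - a) / real (Suc n) < \<delta>"
      using \<delta> by (rule order_tendstoD)
    moreover have "(\<lambda>n. (b - a) powr s * real (Suc n) powr (1 - s)) \<longlonglongrightarrow> 0"
      using assms by real_asymp
    then have "\<forall>\<^sub>F n in sequentially. (b - a) powr s * real (Suc n) powr (1 - s) < e"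
      using e by (rule order_tendstoD)
    ultimately have "\<forall>\<^sub>F n in sequentially. (b - a) / real (Suc n) < \<delta> \<and> (b - a) powr s * real (Suc n) powr (1 - s) < e"
      by (rule eventually_conj)
    then obtain n where n: "(b - a) / real (Suc n) < \<delta>" "(b - a) powr s * real (Suc n) powr (1 - s) < e"
      using eventually_happens'[OF sequentially_bot] by blast
    define w where "w = (b - a) / real (Suc n)"
    define U where "U i = (if i \<le> n then {a + real i * w..a + real (Suc i) * w} else {})" for i
    have w: "0 \<le> w" using assms by (simp add: w_def)
    have diam: "diameter (U i) = (if i \<le> n then w else 0)" for i
      using w by (auto simp: U_def algebra_simps)
    have cover: "A \<subseteq> (\<Union>i. U i)"
    proof
      fix x assume "x \<in> A"
      then have x: "a \<le> x" "x \<le> b" using assms by auto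
      show "x \<in> (\<Union>i. U i)"
      proof (cases "w = 0")
        case True
        then have "x = a" using x by (simp add: w_def)
        then have "x \<in> U 0" using True by (simp add: U_def)
        then show ?thesis by blast
      next
        case False
        then have w: "w > 0" using w by simp
        \<comment> \<open>The minimum with \<open>n\<close> matters for \<open>x = b\<close>, which
          belongs to the last piece although the quotient is \<open>n + 1\<close>.\<close>
        define i where "i = min n (nat \<lfloor>(x - a) / w\<rfloor>)"
        have 1: "real (nat \<lfloor>(x - a) / w\<rfloor>) \<le> (x - a) / w" using x w by simp
        have "real i \<le> (x - a) / w" using 1 by (simp add: i_def)
        moreover have "(x - a) / w \<le> real (Suc i)"
        proof (cases "n \<le> nat \<lfloor>(x - a) / w\<rfloor>")
          case True
          have "(x - a) / w \<le> (b - a) / w" using x w by (intro divide_right_mono) auto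
          also have "\<dots> = real (Suc n)" using w unfolding w_def by (auto simp del: of_nat_Suc)
          finally show ?thesis using True by (simp add: i_def)
        next
          case False
          then show ?thesis using x w by (simp add: i_def) linarith
        qed
        ultimately have "x \<in> U i" using w by (simp add: U_def i_def field_simps)
        then show ?thesis by blast
      qed
    qed
    have bd: "bounded (U i) \<and> diameter (U i) \<le> \<delta>" for i
      unfolding diam using n(1) \<delta> by (auto simp: U_def w_def)
    have wt: "hausdorff_weight s (U i) = (if i \<le> n then ennreal (w powr s) else 0)" for i
      using diam[of i] assms w by (auto simp: hausdorff_weight_def U_def)
    have "hausdorff_premeasure s \<delta> A \<le> (\<Sum>i. hausdorff_weight s (U i))"
      unfolding hausdorff_premeasure_def using cover bd
      by (intro INF_lower) auto
    also have "\<dots> = (\<Sum>i\<in>{..n}. hausdorff_weight s (U i))"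
      by (intro suminf_finite) (auto simp: wt)
    also have "\<dots> = ennreal (real (Suc n) * w powr s)"
      by (simp add: wt ennreal_mult ennreal_of_nat_eq_real_of_nat del: of_nat_Suc)
    also have "real (Suc n) * w powr s = (b - a) powr s * real (Suc n) powr (1 - s)"
      using assms by (simp add: w_def powr_divide powr_diff del: of_nat_Suc)
    also have "ennreal \<dots> \<le> 0 + ennreal e" using n by (simp add: ennreal_leI)
    finally show "hausdorff_premeasure s \<delta> A \<le> 0 + ennreal e" .
  qed
  then show ?thesis by (auto simp: hausdorff_outer_measure_def)
qed

lemma hausdorff_dim_le_1:
  fixes a b :: real
  assumes "A \<subseteq> {a..b}" "a \<le> b"
  shows "hausdorff_dim A \<le> 1"
proof (rule ennreal_le_epsilon)
  fix e :: real assume e: "0 < e"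
  have "hausdorff_dim A \<le> ennreal (1 + e)"
    unfolding hausdorff_dim_def
    using hausdorff_outer_measure_interval_eq_0[OF assms, of "1 + e"] e by (intro Inf_lower CollectI exI[of _ "1 + e"]) auto
  then show "hausdorff_dim A \<le> 1 + ennreal e" using e by simp
qed

text \<open>Disjoint intervals are ordered, so the open intervals between the values of
  \<open>h\<close> at their end points are disjoint too; comparing Lebesgue measures inside
  \<open>{h a..h b}\<close> gives the bound. It serves for the identity and for a return map
  corrected by a linear term.\<close>

lemma sum_increments_le:
  fixes h :: "real \<Rightarrow> real"
  assumes mono: "mono_on {a..b} h" and "a \<le> b" and fin: "finite S"
    and le: "\<And>s. s \<in> S \<Longrightarrow> l s \<le> u s" and sub: "\<And>s. s \<in> S \<Longrightarrow> {l s..u s} \<subseteq> {a..b}"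
    and disj: "\<And>s t. s \<in> S \<Longrightarrow> t \<in> S \<Longrightarrow> s \<noteq> t \<Longrightarrow> {l s..u s} \<inter> {l t..u t} = {}"
  shows "(\<Sum>s\<in>S. h (u s) - h (l s)) \<le> h b - h a"
proof -
  have in_ab: "l s \<in> {a..b}" "u s \<in> {a..b}" if "s \<in> S" for s
    using le[OF that] sub[OF that] by auto
  have inc: "h (l s) \<le> h (u s)" if "s \<in> S" for s
    using mono_onD[OF mono] in_ab[OF that] le[OF that] by blast
  have "disjoint_family_on (\<lambda>s. {h (l s)<..<h (u s)}) S"
    unfolding disjoint_family_on_def
  proof (intro ballI impI)
    fix s t assume st: "s \<in> S" "t \<in> S" "s \<noteq> t"
    have "u s < l t \<or> u t < l s"
    proof (rule ccontr)
      assume "\<not> ?thesis"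
      then have "max (l s) (l t) \<in> {l s..u s} \<inter> {l t..u t}" using le[OF st(1)] le[OF st(2)] by auto
      then show False using disj[OF st] by blast
    qed
    then have "h (u s) \<le> h (l t) \<or> h (u t) \<le> h (l s)"
      using mono_onD[OF mono] in_ab[OF st(1)] in_ab[OF st(2)] by (meson less_imp_le)
    then show "{h (l s)<..<h (u s)} \<inter> {h (l t)<..<h (u t)} = {}" by auto
  qed
  then have "(\<Sum>s\<in>S. emeasure lborel {h (l s)<..<h (u s)}) = emeasure lborel (\<Union>s\<in>S. {h (l s)<..<h (u s)})"
    using fin by (intro sum_emeasure) auto
  also have "\<dots> \<le> emeasure lborel {h a..h b}"
  proof (rule emeasure_mono)
    have "h a \<le> h (l s) \<and> h (u s) \<le> h b" if "s \<in> S" for s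
      using mono_onD[OF mono] in_ab[OF that] \<open>a \<le> b\<close> by auto
    then show "(\<Union>s\<in>S. {h (l s)<..<h (u s)}) \<subseteq> {h a..h b}" by fastforce
  qed auto
  also have "\<dots> = ennreal (h b - h a)"
    using mono_onD[OF mono] \<open>a \<le> b\<close> by simp
  also have "(\<Sum>s\<in>S. emeasure lborel {h (l s)<..<h (u s)}) = ennreal (\<Sum>s\<in>S. h (u s) - h (l s))"
    using inc by (subst sum_ennreal[symmetric]) auto
  finally show ?thesis
    using mono_onD[OF mono] \<open>a \<le> b\<close> by (subst (asm) ennreal_le_iff) auto
qed

section \<open>Cylinders of the induced map\<close>

locale expanding_returns =
  fixes a b c d :: real and f :: "real \<Rightarrow> real" and R :: "real \<Rightarrow> enat" and \<Lambda> C :: real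
  assumes ab: "a < b" and cd: "c < d" and J_subset: "{c..d} \<subseteq> {a..b}"
    and f_into: "f ` {a..b} \<subseteq> {a..b}"
    and f_diff: "\<And>x. x \<in> {a..b} \<Longrightarrow> f differentiable (at x within {a..b})"
    and R_pos: "\<And>x. x \<in> {c..d} \<Longrightarrow> R x \<noteq> 0"
    and \<Lambda>: "\<Lambda> > 1" and C: "C \<ge> 1"
    and full: "\<And>n V. n \<ge> 1 \<Longrightarrow> V \<in> components {x \<in> {c..d}. R x = enat n} \<Longrightarrow> (f ^^ n) ` V = {c..d}"
    and expand: "\<And>n V x. n \<ge> 1 \<Longrightarrow> V \<in> components {x \<in> {c..d}. R x = enat n} \<Longrightarrow> x \<in> V \<Longrightarrow>
        \<Lambda> \<le> \<bar>iter_deriv {a..b} f n x\<bar>"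
    and distortion: "\<And>ks B y z. return_composition (sum_list ks) ks \<Longrightarrow>
        B \<in> components (return_cylinder f {c..d} R ks) \<Longrightarrow> y \<in> B \<Longrightarrow> z \<in> B \<Longrightarrow>
        \<bar>iter_deriv {a..b} f (sum_list ks) y\<bar> / \<bar>iter_deriv {a..b} f (sum_list ks) z\<bar> \<le> C"
begin

abbreviation I :: "real set" where "I \<equiv> {a..b}"
abbreviation J :: "real set" where "J \<equiv> {c..d}"
abbreviation D :: "nat \<Rightarrow> real \<Rightarrow> real" where "D \<equiv> iter_deriv I f"

definition branches :: "(nat \<times> real set) set" where
  "branches = {(k, V). V \<in> components {x \<in> J. R x = enat k}}"

abbreviation time :: "(nat \<times> real set) list \<Rightarrow> nat" where
  "time xs \<equiv> sum_list (map fst xs)"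

text \<open>Finer than \<open>return_cylinder\<close>, which fixes the return times only and may
  have many components: here the branches themselves are fixed. The recursion adds a digit in front
  because a cylinder is the image of a shorter one under an inverse branch.\<close>

primrec cyl :: "(nat \<times> real set) list \<Rightarrow> real set" where
  "cyl [] = J"
| "cyl (s # xs) = {x \<in> snd s. (f ^^ fst s) x \<in> cyl xs}"

definition len :: "(nat \<times> real set) list \<Rightarrow> real" where
  "len xs = measure lborel (cyl xs)"

section \<open>Derivatives of iterates and the mean value theorem\<close>

lemma iter_into: "x \<in> I \<Longrightarrow> (f ^^ n) x \<in> I"
  using funpow_in[OF f_into] .

lemma D_unique:
  assumes "x \<in> I" "((f ^^ n) has_real_derivative E) (at x within I)"
  shows "D n x = E"
  using assms by (intro vector_derivative_within_closed_interval[OF ab])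
    (simp_all add: has_real_derivative_iff_has_vector_derivative)

lemma has_real_derivative_iter:
  assumes "x \<in> I"
  shows "((f ^^ n) has_real_derivative D n x) (at x within I)"
proof -
  have "\<exists>E. ((f ^^ n) has_real_derivative E) (at x within I)"
  proof (induction n)
    case 0
    show ?case by (auto simp: id_def intro!: exI DERIV_ident)
  next
    case (Suc n)
    then obtain E where E: "((f ^^ n) has_real_derivative E) (at x within I)" by blast
    obtain E' where "(f has_real_derivative E') (at ((f ^^ n) x) within I)"
      using f_diff[OF iter_into[OF assms]] by (auto simp: real_differentiable_def)
    then have "(f has_real_derivative E') (at ((f ^^ n) x) within (f ^^ n) ` I)"
      by (rule has_field_derivative_subset) (use iter_into in auto)
    from DERIV_image_chain[OF this E] show ?case by (auto simp: o_def)
  qed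
  then show ?thesis using D_unique[OF assms] by metis
qed

lemma D_add:
  assumes "x \<in> I"
  shows "D (n + m) x = D m ((f ^^ n) x) * D n x"
proof (rule D_unique[OF assms])
  have "((f ^^ m) has_real_derivative D m ((f ^^ n) x)) (at ((f ^^ n) x) within (f ^^ n) ` I)"
    by (rule has_field_derivative_subset[OF has_real_derivative_iter[OF iter_into[OF assms]]]) (use iter_into in auto)
  from DERIV_image_chain[OF this has_real_derivative_iter[OF assms]]
  show "((f ^^ (n + m)) has_real_derivative D m ((f ^^ n) x) * D n x) (at x within I)"
    by (simp add: add.commute[of n] funpow_add)
qed

lemma D_0: "x \<in> I \<Longrightarrow> D 0 x = 1"
  by (rule D_unique) (auto simp: id_def)

lemma continuous_on_iter: "continuous_on I (f ^^ n)"
  using has_real_derivative_iter by (rule DERIV_continuous_on)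

lemma iter_mvt:
  assumes "connected B" "B \<subseteq> I" "x \<in> B" "y \<in> B"
  shows "\<exists>\<xi>\<in>B. \<bar>(f ^^ n) x - (f ^^ n) y\<bar> = \<bar>D n \<xi>\<bar> * \<bar>x - y\<bar>"
proof -
  have *: "\<exists>\<xi>\<in>B. \<bar>(f ^^ n) x - (f ^^ n) y\<bar> = \<bar>D n \<xi>\<bar> * \<bar>x - y\<bar>"
    if "x \<in> B" "y \<in> B" "x \<le> y" for x y
  proof -
    have sub: "{x..y} \<subseteq> B" using assms(1) that by (simp add: connected_contains_Icc)
    have "\<exists>\<xi>\<in>{x..y}. (f ^^ n) y - (f ^^ n) x = (*) (D n \<xi>) (y - x)"
    proof (rule mvt_very_simple[OF that(3)])
      fix \<xi> assume "x \<le> \<xi>" "\<xi> \<le> y"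
      moreover have "{x..y} \<subseteq> I" using sub assms(2) by (rule subset_trans)
      ultimately have "((f ^^ n) has_real_derivative D n \<xi>) (at \<xi> within {x..y})"
        by (intro has_field_derivative_subset[OF has_real_derivative_iter, of _ "{x..y}"]) auto
      then show "((f ^^ n) has_derivative (*) (D n \<xi>)) (at \<xi> within {x..y})"
        by (rule has_field_derivative_imp_has_derivative)
    qed
    then obtain \<xi> where "\<xi> \<in> {x..y}" "(f ^^ n) y - (f ^^ n) x = D n \<xi> * (y - x)" by auto
    then show ?thesis using sub
      by (intro bexI[of _ \<xi>]) (auto simp: abs_minus_commute[of "(f ^^ n) x"] abs_minus_commute[of x] abs_mult)
  qed
  show ?thesis
    using *[OF assms(3,4)] *[OF assms(4,3)] by (cases "x \<le> y") (auto simp: abs_minus_commute)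
qed

section \<open>Branches, their inverses, and cylinders as compact intervals\<close>

lemma branchD:
  assumes "s \<in> branches"
  shows "snd s \<subseteq> J" "connected (snd s)" "(f ^^ fst s) ` snd s = J" "x \<in> snd s \<Longrightarrow> \<Lambda> \<le> \<bar>D (fst s) x\<bar>"
    "x \<in> snd s \<Longrightarrow> R x = enat (fst s)" "fst s \<ge> 1"
proof -
  obtain k V where s: "s = (k, V)" and V: "V \<in> components {x \<in> J. R x = enat k}"
    using assms by (auto simp: branches_def)
  have sub: "V \<subseteq> {x \<in> J. R x = enat k}" using V by (rule in_components_subset)
  moreover obtain y where "y \<in> V" using in_components_nonempty[OF V] by blast
  \<comment> \<open>Positivity of \<open>R\<close> excludes \<open>k = 0\<close>, for which
    \<open>full\<close> and \<open>expand\<close> give no information.\<close>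
  ultimately have k: "k \<ge> 1" using R_pos[of y] by (cases k) (auto simp: zero_enat_def)
  show "snd s \<subseteq> J" "x \<in> snd s \<Longrightarrow> R x = enat (fst s)" using sub s by auto
  show "connected (snd s)" using in_components_connected[OF V] s by simp
  show "(f ^^ fst s) ` snd s = J" "x \<in> snd s \<Longrightarrow> \<Lambda> \<le> \<bar>D (fst s) x\<bar>" "fst s \<ge> 1"
    using full[OF k V] expand[OF k V] k s by auto
qed

lemma branches_disjoint:
  assumes "s \<in> branches" "t \<in> branches" "s \<noteq> t"
  shows "snd s \<inter> snd t = {}"
proof (cases "fst s = fst t")
  case True
  then show ?thesis
    using assms components_nonoverlap[of "snd s" "{x \<in> J. R x = enat (fst s)}" "snd t"]
    by (auto simp: branches_def prod_eq_iff)
next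
  case False
  then show ?thesis using branchD(5)[OF assms(1)] branchD(5)[OF assms(2)] by fastforce
qed

text \<open>By the mean value theorem a branch does not decrease distances, so its inverse is
  1-Lipschitz. This is what makes branches compact: they are continuous images of
  \<open>J\<close>.\<close>

lemma continuous_on_inverse_branch:
  assumes s: "s \<in> branches"
  shows "continuous_on J (inv_into (snd s) (f ^^ fst s))" "inj_on (f ^^ fst s) (snd s)"
proof -
  have ex: "\<bar>x - y\<bar> \<le> \<bar>(f ^^ fst s) x - (f ^^ fst s) y\<bar>" if "x \<in> snd s" "y \<in> snd s" for x y
  proof -
    have "snd s \<subseteq> I" using branchD(1)[OF s] J_subset by blast
    from iter_mvt[OF branchD(2)[OF s] this that, of "fst s"]
    obtain \<xi> where "\<xi> \<in> snd s" "\<bar>(f ^^ fst s) x - (f ^^ fst s) y\<bar> = \<bar>D (fst s) \<xi>\<bar> * \<bar>x - y\<bar>"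
      by blast
    moreover have "1 * \<bar>x - y\<bar> \<le> \<bar>D (fst s) \<xi>\<bar> * \<bar>x - y\<bar>"
      using branchD(4)[OF s, of \<xi>] \<Lambda> \<open>\<xi> \<in> snd s\<close> by (intro mult_right_mono) auto
    ultimately show ?thesis by simp
  qed
  then show "inj_on (f ^^ fst s) (snd s)" by (fastforce intro: inj_onI)
  show "continuous_on J (inv_into (snd s) (f ^^ fst s))"
    unfolding continuous_on_iff
  proof (intro ballI allI impI)
    fix x e :: real assume "x \<in> J" "e > 0"
    have "dist (inv_into (snd s) (f ^^ fst s) y) (inv_into (snd s) (f ^^ fst s) x) < e"
      if "y \<in> J" "dist y x < e" for y
      using ex[OF inv_into_into inv_into_into, of y "f ^^ fst s" x "f ^^ fst s"] \<open>x \<in> J\<close> that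
        f_inv_into_f[of y "f ^^ fst s" "snd s"] f_inv_into_f[of x "f ^^ fst s" "snd s"] branchD(3)[OF s]
      by (auto simp: dist_real_def)
    with \<open>e > 0\<close> show "\<exists>\<delta>>0. \<forall>y\<in>J. dist y x < \<delta> \<longrightarrow>
        dist (inv_into (snd s) (f ^^ fst s) y) (inv_into (snd s) (f ^^ fst s) x) < e" by blast
  qed
qed

text \<open>Induction from the left: the inverse branch of the first digit carries the cylinder of
  the remaining word onto the whole cylinder, and the chain rule multiplies the expansion
  factors.\<close>

lemma cyl_props:
  assumes "set xs \<subseteq> branches"
  shows "connected (cyl xs)" "compact (cyl xs)" "cyl xs \<subseteq> J" "(f ^^ time xs) ` cyl xs = J"
    "x \<in> cyl xs \<Longrightarrow> \<Lambda> ^ length xs \<le> \<bar>D (time xs) x\<bar>"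
proof -
  have "connected (cyl xs) \<and> compact (cyl xs) \<and> cyl xs \<subseteq> J \<and> (f ^^ time xs) ` cyl xs = J \<and>
      (\<forall>x\<in>cyl xs. \<Lambda> ^ length xs \<le> \<bar>D (time xs) x\<bar>)"
    using assms
  proof (induction xs)
    case Nil
    then show ?case using J_subset D_0 by (auto simp: id_def[symmetric] subset_iff)
  next
    case (Cons s xs)
    then have s: "s \<in> branches" and IH: "connected (cyl xs)" "compact (cyl xs)" "cyl xs \<subseteq> J"
      "(f ^^ time xs) ` cyl xs = J" "\<And>x. x \<in> cyl xs \<Longrightarrow> \<Lambda> ^ length xs \<le> \<bar>D (time xs) x\<bar>" by auto
    let ?F = "f ^^ fst s" and ?g = "inv_into (snd s) (f ^^ fst s)"
    note g = continuous_on_inverse_branch[OF s]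
    have eq: "cyl (s # xs) = ?g ` cyl xs"
    proof (intro equalityI subsetI)
      fix x assume "x \<in> cyl (s # xs)"
      then show "x \<in> ?g ` cyl xs"
        using inv_into_f_f[OF g(2)] by (intro image_eqI[of _ _ "?F x"]) auto
    next
      fix x assume "x \<in> ?g ` cyl xs"
      then obtain y where "y \<in> cyl xs" "x = ?g y" by blast
      then show "x \<in> cyl (s # xs)"
        using branchD(3)[OF s] IH(3) inv_into_into[of y ?F "snd s"] f_inv_into_f[of y ?F "snd s"] by auto
    qed
    have im: "?F ` cyl (s # xs) = cyl xs"
      using branchD(3)[OF s] IH(3) by auto
    have cont: "continuous_on (cyl xs) ?g" using g(1) IH(3) by (rule continuous_on_subset)
    have sub: "cyl (s # xs) \<subseteq> J" using branchD(1)[OF s] by auto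
    have "connected (cyl (s # xs))" "compact (cyl (s # xs))"
      unfolding eq using cont IH(1,2) by (auto intro: connected_continuous_image compact_continuous_image)
    moreover have "(f ^^ time (s # xs)) ` cyl (s # xs) = (f ^^ time xs) ` (?F ` cyl (s # xs))"
      by (simp add: add.commute[of "fst s"] funpow_add image_comp del: cyl.simps)
    then have "(f ^^ time (s # xs)) ` cyl (s # xs) = J" unfolding im IH(4) .
    moreover have "\<Lambda> ^ length (s # xs) \<le> \<bar>D (time (s # xs)) x\<bar>" if x: "x \<in> cyl (s # xs)" for x
    proof -
      have "x \<in> I" using x sub J_subset by blast
      then have "\<bar>D (time (s # xs)) x\<bar> = \<bar>D (time xs) (?F x)\<bar> * \<bar>D (fst s) x\<bar>"
        by (simp add: D_add abs_mult)
      also have "\<dots> \<ge> \<Lambda> ^ length xs * \<Lambda>"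
        using x IH(5) branchD(4)[OF s] \<Lambda> by (intro mult_mono) auto
      finally show ?thesis by (simp add: mult.commute)
    qed
    ultimately show ?case using sub by blast
  qed
  then show "connected (cyl xs)" "compact (cyl xs)" "cyl xs \<subseteq> J" "(f ^^ time xs) ` cyl xs = J"
    "x \<in> cyl xs \<Longrightarrow> \<Lambda> ^ length xs \<le> \<bar>D (time xs) x\<bar>" by auto
qed

lemma cyl_iter_in: "set xs \<subseteq> branches \<Longrightarrow> x \<in> cyl xs \<Longrightarrow> (f ^^ time xs) x \<in> J"
  using cyl_props(4) by blast

lemma cyl_interval:
  assumes "set xs \<subseteq> branches"
  obtains l u where "l < u" "cyl xs = {l..u}" "len xs = u - l"
proof -
  obtain l u where lu: "cyl xs = {l..u}"
    using cyl_props(1,2)[OF assms] connected_compact_interval_1[of "cyl xs"] by blast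
  have "c \<in> (f ^^ time xs) ` {l..u}" "d \<in> (f ^^ time xs) ` {l..u}"
    using cyl_props(4)[OF assms] cd lu by auto
  then obtain x y where "x \<in> {l..u}" "y \<in> {l..u}" "(f ^^ time xs) x = c" "(f ^^ time xs) y = d"
    by (auto simp: image_iff)
  then have "x \<noteq> y" "l \<le> x" "x \<le> u" "l \<le> y" "y \<le> u" using cd by auto
  then have "l < u" by linarith
  then show ?thesis using that[of l u] lu by (simp add: len_def)
qed

lemma len_pos: "set xs \<subseteq> branches \<Longrightarrow> len xs > 0"
  by (rule cyl_interval[of xs]) auto

lemma dist_le_len:
  assumes "set xs \<subseteq> branches" "x \<in> cyl xs" "y \<in> cyl xs"
  shows "\<bar>x - y\<bar> \<le> len xs"
proof -
  obtain l u where "cyl xs = {l..u}" "len xs = u - l" using assms(1) by (rule cyl_interval)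
  then show ?thesis using assms(2,3) by auto
qed

lemma cyl_append: "set xs \<subseteq> branches \<Longrightarrow> set ys \<subseteq> branches \<Longrightarrow>
    cyl (xs @ ys) = {x \<in> cyl xs. (f ^^ time xs) x \<in> cyl ys}"
proof (induction xs)
  case Nil
  then show ?case using cyl_props(3)[of ys] by auto
next
  case (Cons s xs)
  then show ?case by (auto simp: add.commute[of "fst s"] funpow_add)
qed

lemma cyl_singleton: "s \<in> branches \<Longrightarrow> cyl [s] = snd s"
  using branchD(3)[of s] by fastforce

lemma cyl_snoc: "set xs \<subseteq> branches \<Longrightarrow> s \<in> branches \<Longrightarrow>
    cyl (xs @ [s]) = {x \<in> cyl xs. (f ^^ time xs) x \<in> snd s}"
  using cyl_append[of xs "[s]"] cyl_singleton[of s] by (simp del: cyl.simps)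

section \<open>Bounded distortion on cylinders; lengths and gaps of their children\<close>

lemma cyl_subset_return_cylinder:
  "set xs \<subseteq> branches \<Longrightarrow> cyl xs \<subseteq> return_cylinder f J R (map fst xs)"
proof (induction xs)
  case Nil
  then show ?case by (auto simp: return_cylinder_def)
next
  case (Cons s xs)
  then have s: "s \<in> branches" and IH: "cyl xs \<subseteq> return_cylinder f J R (map fst xs)" by auto
  show ?case
  proof
    fix x assume x: "x \<in> cyl (s # xs)"
    then have "R ((f ^^ sum_list (take j (map fst (s # xs)))) x) = enat (map fst (s # xs) ! j)"
      if "j < length (map fst (s # xs))" for j
      using that IH branchD(5)[OF s, of x]
      by (cases j) (auto simp: return_cylinder_def add.commute[of "fst s"] funpow_add)
    moreover have "x \<in> J" using x branchD(1)[OF s] by auto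
    ultimately show "x \<in> return_cylinder f J R (map fst (s # xs))"
      by (auto simp: return_cylinder_def)
  qed
qed

text \<open>The hypothesis \<open>distortion\<close> speaks of components of return cylinders. A
  cylinder is connected, hence inside one of them. The empty word is treated apart since it is no
  \<open>return_composition\<close>.\<close>

lemma cyl_distortion:
  assumes xs: "set xs \<subseteq> branches" and y: "y \<in> cyl xs" and z: "z \<in> cyl xs"
  shows "\<bar>D (time xs) y\<bar> \<le> C * \<bar>D (time xs) z\<bar>"
proof (cases "xs = []")
  case True
  then show ?thesis using y z J_subset C D_0 by (auto simp: subset_iff)
next
  case False
  have sub: "cyl xs \<subseteq> return_cylinder f J R (map fst xs)" by (rule cyl_subset_return_cylinder[OF xs])
  then obtain B where B: "B \<in> components (return_cylinder f J R (map fst xs))" "cyl xs \<subseteq> B"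
    using exists_component_superset[OF sub _ cyl_props(1)[OF xs]] y by blast
  have "\<bar>D (time xs) y\<bar> / \<bar>D (time xs) z\<bar> \<le> C"
    using B y z False branchD(6) xs
    by (intro distortion[of "map fst xs" B]) (auto simp: return_composition_def)
  moreover have "0 < \<bar>D (time xs) z\<bar>"
    using cyl_props(5)[OF xs z] \<Lambda> by (meson less_le_trans zero_less_one zero_less_power order_less_trans)
  ultimately show ?thesis by (simp add: divide_le_eq)
qed

lemma cyl_subset_I: "set xs \<subseteq> branches \<Longrightarrow> cyl xs \<subseteq> I"
  using cyl_props(3) J_subset by blast

lemma cyl_expand:
  assumes xs: "set xs \<subseteq> branches" and x: "x \<in> cyl xs" and y: "y \<in> cyl xs"
  shows "\<Lambda> ^ length xs * \<bar>x - y\<bar> \<le> \<bar>(f ^^ time xs) x - (f ^^ time xs) y\<bar>"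
proof -
  obtain \<xi> where "\<xi> \<in> cyl xs" "\<bar>(f ^^ time xs) x - (f ^^ time xs) y\<bar> = \<bar>D (time xs) \<xi>\<bar> * \<bar>x - y\<bar>"
    using iter_mvt[OF cyl_props(1)[OF xs] cyl_subset_I[OF xs] x y] by blast
  then show ?thesis using cyl_props(5)[OF xs] by (auto intro: mult_right_mono)
qed

lemma cyl_diam_le:
  assumes xs: "set xs \<subseteq> branches" and x: "x \<in> cyl xs" and y: "y \<in> cyl xs"
  shows "\<bar>x - y\<bar> \<le> (d - c) / \<Lambda> ^ length xs"
proof -
  have "\<bar>(f ^^ time xs) x - (f ^^ time xs) y\<bar> \<le> d - c"
    using cyl_iter_in[OF xs x] cyl_iter_in[OF xs y] by auto
  then have "\<Lambda> ^ length xs * \<bar>x - y\<bar> \<le> d - c" using cyl_expand[OF assms] by linarith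
  then show ?thesis using \<Lambda> by (simp add: field_simps)
qed

lemma len_le: "set xs \<subseteq> branches \<Longrightarrow> len xs \<le> (d - c) / \<Lambda> ^ length xs"
proof -
  assume xs: "set xs \<subseteq> branches"
  then obtain l u where "l < u" "cyl xs = {l..u}" "len xs = u - l" by (rule cyl_interval)
  then show "len xs \<le> (d - c) / \<Lambda> ^ length xs" using cyl_diam_le[OF xs, of l u] by auto
qed

text \<open>The mean slope over the whole cylinder is at most \<open>(d - c) / len xs\<close> and is
  attained at some point; distortion spreads this bound to all points at the cost of
  \<open>C\<close>.\<close>

lemma cyl_lipschitz:
  assumes xs: "set xs \<subseteq> branches" and x: "x \<in> cyl xs" and y: "y \<in> cyl xs"
  shows "\<bar>(f ^^ time xs) x - (f ^^ time xs) y\<bar> * len xs \<le> C * (d - c) * \<bar>x - y\<bar>"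
proof -
  let ?G = "f ^^ time xs"
  note mvt = iter_mvt[OF cyl_props(1)[OF xs] cyl_subset_I[OF xs]]
  obtain l u where lu: "l < u" "cyl xs = {l..u}" "len xs = u - l" using xs by (rule cyl_interval)
  then have "l \<in> cyl xs" "u \<in> cyl xs" by auto
  then obtain \<zeta> where \<zeta>: "\<zeta> \<in> cyl xs" "\<bar>?G l - ?G u\<bar> = \<bar>D (time xs) \<zeta>\<bar> * \<bar>l - u\<bar>" using mvt by blast
  obtain \<xi> where \<xi>: "\<xi> \<in> cyl xs" "\<bar>?G x - ?G y\<bar> = \<bar>D (time xs) \<xi>\<bar> * \<bar>x - y\<bar>" using mvt x y by blast
  have "\<bar>?G l - ?G u\<bar> \<le> d - c"
    using cyl_iter_in[OF xs \<open>l \<in> cyl xs\<close>] cyl_iter_in[OF xs \<open>u \<in> cyl xs\<close>] by auto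
  then have 1: "\<bar>D (time xs) \<zeta>\<bar> * len xs \<le> d - c" using \<zeta>(2) lu by simp
  have "\<bar>?G x - ?G y\<bar> * len xs \<le> C * \<bar>D (time xs) \<zeta>\<bar> * \<bar>x - y\<bar> * len xs"
    unfolding \<xi>(2) using cyl_distortion[OF xs \<xi>(1) \<zeta>(1)] len_pos[OF xs] by (intro mult_right_mono) auto
  also have "\<dots> = C * \<bar>x - y\<bar> * (\<bar>D (time xs) \<zeta>\<bar> * len xs)" by simp
  also have "\<dots> \<le> C * \<bar>x - y\<bar> * (d - c)" using 1 C by (intro mult_left_mono) auto
  finally show ?thesis by (simp add: mult_ac)
qed

text \<open>Dual to the Lipschitz bound: between preimages of \<open>c\<close> and \<open>d\<close>
  the mean slope is at least \<open>(d - c) / len xs\<close>, hence the slope is at least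
  \<open>1 / C\<close> times this everywhere.\<close>

lemma cyl_colipschitz:
  assumes xs: "set xs \<subseteq> branches" and x: "x \<in> cyl xs" and y: "y \<in> cyl xs"
  shows "(d - c) * \<bar>x - y\<bar> \<le> C * len xs * \<bar>(f ^^ time xs) x - (f ^^ time xs) y\<bar>"
proof -
  let ?G = "f ^^ time xs"
  note mvt = iter_mvt[OF cyl_props(1)[OF xs] cyl_subset_I[OF xs]]
  have "c \<in> ?G ` cyl xs" "d \<in> ?G ` cyl xs" using cyl_props(4)[OF xs] cd by auto
  then obtain p q where pq: "p \<in> cyl xs" "q \<in> cyl xs" "?G p = c" "?G q = d" by auto
  then obtain \<zeta> where \<zeta>: "\<zeta> \<in> cyl xs" "\<bar>c - d\<bar> = \<bar>D (time xs) \<zeta>\<bar> * \<bar>p - q\<bar>" using mvt by metis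
  obtain \<xi> where \<xi>: "\<xi> \<in> cyl xs" "\<bar>?G x - ?G y\<bar> = \<bar>D (time xs) \<xi>\<bar> * \<bar>x - y\<bar>" using mvt x y by blast
  have "d - c \<le> \<bar>D (time xs) \<zeta>\<bar> * len xs"
    using \<zeta>(2) cd mult_left_mono[OF dist_le_len[OF xs pq(1,2)], of "\<bar>D (time xs) \<zeta>\<bar>"] by linarith
  also have "\<dots> \<le> C * \<bar>D (time xs) \<xi>\<bar> * len xs"
    using cyl_distortion[OF xs \<zeta>(1) \<xi>(1)] len_pos[OF xs] by (intro mult_right_mono) auto
  finally have "(d - c) * \<bar>x - y\<bar> \<le> C * \<bar>D (time xs) \<xi>\<bar> * len xs * \<bar>x - y\<bar>"
    by (intro mult_right_mono) auto
  then show ?thesis unfolding \<xi>(2) by (simp add: mult_ac)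
qed

text \<open>The price of a forced digit: the child keeps a proportion of its parent that depends on
  \<open>s\<close> but not on \<open>xs\<close>.\<close>

lemma child_len_ge:
  assumes xs: "set xs \<subseteq> branches" and s: "s \<in> branches"
  shows "len [s] / (C * (d - c)) * len xs \<le> len (xs @ [s])"
proof -
  let ?G = "f ^^ time xs"
  have xss: "set (xs @ [s]) \<subseteq> branches" and s': "set [s] \<subseteq> branches" using xs s by auto
  obtain l u where lu: "l < u" "cyl [s] = {l..u}" "len [s] = u - l" using s' by (rule cyl_interval)
  have "l \<in> cyl [s]" "u \<in> cyl [s]" using lu by auto
  moreover have "cyl [s] \<subseteq> ?G ` cyl xs" using cyl_props(3)[OF s'] cyl_props(4)[OF xs] by blast
  ultimately have "l \<in> ?G ` cyl xs" "u \<in> ?G ` cyl xs" by blast+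
  then obtain p q where pq: "p \<in> cyl xs" "q \<in> cyl xs" "?G p = l" "?G q = u" by (auto simp del: cyl.simps)
  then have "p \<in> cyl (xs @ [s])" "q \<in> cyl (xs @ [s])"
    using \<open>l \<in> cyl [s]\<close> \<open>u \<in> cyl [s]\<close> cyl_append[OF xs s'] by auto
  then have "\<bar>p - q\<bar> \<le> len (xs @ [s])" by (rule dist_le_len[OF xss])
  moreover have "len [s] * len xs \<le> C * (d - c) * \<bar>p - q\<bar>"
    using cyl_lipschitz[OF xs pq(1,2)] pq lu by simp
  ultimately have "len [s] * len xs \<le> C * (d - c) * len (xs @ [s])"
    using C cd by (meson diff_ge_0_iff_ge less_imp_le mult_left_mono mult_nonneg_nonneg order_trans zero_le_one)
  then show ?thesis using C cd by (simp add: field_simps)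
qed

text \<open>A gap between two branches is pulled back by the Lipschitz bound, so children are
  separated in proportion to the length of their parent. This is the separation hypothesis of
  \<open>tree_limit_content\<close>.\<close>

lemma children_gap:
  assumes xs: "set xs \<subseteq> branches" and st: "s \<in> branches" "t \<in> branches"
    and gap: "\<And>v w. v \<in> snd s \<Longrightarrow> w \<in> snd t \<Longrightarrow> \<kappa> \<le> \<bar>v - w\<bar>"
    and x: "x \<in> cyl (xs @ [s])" and y: "y \<in> cyl (xs @ [t])"
  shows "\<kappa> / (C * (d - c)) * len xs \<le> \<bar>x - y\<bar>"
proof -
  let ?G = "f ^^ time xs"
  have xy: "x \<in> cyl xs" "?G x \<in> snd s" "y \<in> cyl xs" "?G y \<in> snd t"
    using x y cyl_snoc[OF xs] st by auto
  have "\<kappa> * len xs \<le> \<bar>?G x - ?G y\<bar> * len xs"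
    using gap[OF xy(2,4)] len_pos[OF xs] by (intro mult_right_mono) auto
  also have "\<dots> \<le> C * (d - c) * \<bar>x - y\<bar>" using cyl_lipschitz[OF xs xy(1,3)] .
  finally show ?thesis using C cd by (simp add: field_simps)
qed

text \<open>The sign \<open>\<sigma>\<close> allows increasing and decreasing return maps to be
  handled together.\<close>

lemma cyl_monotone:
  assumes xs: "set xs \<subseteq> branches"
  obtains \<sigma> :: real where "\<And>x y. x \<in> cyl xs \<Longrightarrow> y \<in> cyl xs \<Longrightarrow> x \<le> y \<Longrightarrow>
    \<sigma> * (f ^^ time xs) y - \<sigma> * (f ^^ time xs) x = \<bar>(f ^^ time xs) y - (f ^^ time xs) x\<bar>"
proof -
  let ?G = "f ^^ time xs"
  have "inj_on ?G (cyl xs)"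
  proof (rule inj_onI)
    fix x y assume "x \<in> cyl xs" "y \<in> cyl xs" "?G x = ?G y"
    then have "\<Lambda> ^ length xs * \<bar>x - y\<bar> \<le> 0" using cyl_expand[OF xs, of x y] by simp
    moreover have "0 < \<Lambda> ^ length xs" using \<Lambda> by simp
    ultimately show "x = y" by (simp add: mult_le_0_iff)
  qed
  then have "strict_mono_on (cyl xs) ?G \<or> strict_antimono_on (cyl xs) ?G"
    using injective_eq_monotone_map[of "cyl xs" ?G] cyl_props(1)[OF xs]
      continuous_on_subset[OF continuous_on_iter cyl_subset_I[OF xs]]
    by (simp add: is_interval_connected_1)
  then show ?thesis
  proof
    assume m: "strict_mono_on (cyl xs) ?G"
    show ?thesis by (rule that[of 1]) (use strict_mono_onD[OF m] in fastforce)
  next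
    assume m: "strict_antimono_on (cyl xs) ?G"
    show ?thesis by (rule that[of "-1"]) (use monotone_onD[OF m] in \<open>fastforce simp: le_less\<close>)
  qed
qed

text \<open>On a cylinder of length \<open>len xs\<close> the absolute value of the derivative of the return map is
  at least \<open>\<mu> = (d - c) / (C * len xs)\<close>; so the function \<open>h\<close> below is monotone, and its increments over
  the children sum up to at most its total increment.\<close>

lemma sum_children_len_ge:
  assumes xs: "set xs \<subseteq> branches" and S: "finite S" "S \<subseteq> branches"
    and mass: "(1 - \<delta>) * (d - c) \<le> (\<Sum>s\<in>S. len [s])"
  shows "(1 - C * \<delta>) * len xs \<le> (\<Sum>s\<in>S. len (xs @ [s]))"
proof -
  let ?G = "f ^^ time xs"
  obtain \<sigma> :: real where \<sigma>: "\<And>x y. x \<in> cyl xs \<Longrightarrow> y \<in> cyl xs \<Longrightarrow> x \<le> y \<Longrightarrow>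
      \<sigma> * ?G y - \<sigma> * ?G x = \<bar>?G y - ?G x\<bar>"
    using cyl_monotone[OF xs] by blast
  define \<mu> where "\<mu> = (d - c) / (C * len xs)"
  have \<mu>: "\<mu> > 0" using C cd len_pos[OF xs] by (simp add: \<mu>_def)
  define h where "h x = \<sigma> * ?G x - \<mu> * x" for x
  obtain a' b' where ab': "a' < b'" "cyl xs = {a'..b'}" "len xs = b' - a'" using xs by (rule cyl_interval)
  have "\<exists>l u. l < u \<and> cyl (xs @ [s]) = {l..u} \<and> len (xs @ [s]) = u - l" if "s \<in> S" for s
  proof -
    have "set (xs @ [s]) \<subseteq> branches" using xs S that by auto
    from cyl_interval[OF this] show ?thesis by metis
  qed
  then obtain l u where lu: "\<And>s. s \<in> S \<Longrightarrow> l s < u s" "\<And>s. s \<in> S \<Longrightarrow> cyl (xs @ [s]) = {l s..u s}"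
      "\<And>s. s \<in> S \<Longrightarrow> len (xs @ [s]) = u s - l s" by metis
  have sub: "{l s..u s} \<subseteq> {a'..b'}" if "s \<in> S" for s
    using cyl_snoc[OF xs, of s] lu(2)[OF that] ab'(2) S that by (auto simp del: atLeastatMost_subset_iff)
  have "mono_on {a'..b'} h"
  proof (rule mono_onI)
    fix x y assume xy: "x \<in> {a'..b'}" "y \<in> {a'..b'}" "x \<le> y"
    then have "(d - c) * (y - x) \<le> C * len xs * (\<sigma> * ?G y - \<sigma> * ?G x)"
      using cyl_colipschitz[OF xs, of y x] \<sigma>[of x y] ab' by simp
    then have "\<mu> * (y - x) \<le> \<sigma> * ?G y - \<sigma> * ?G x"
      using C len_pos[OF xs] by (simp add: \<mu>_def field_simps)
    then show "h x \<le> h y" by (simp add: h_def algebra_simps)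
  qed
  then have "(\<Sum>s\<in>S. h (u s) - h (l s)) \<le> h b' - h a'"
  proof (rule sum_increments_le)
    show "{l s..u s} \<inter> {l t..u t} = {}" if "s \<in> S" "t \<in> S" "s \<noteq> t" for s t
    proof -
      have "s \<in> branches" "t \<in> branches" using S that by auto
      then have "cyl (xs @ [s]) \<inter> cyl (xs @ [t]) = {}"
        using branches_disjoint[of s t] that(3) by (auto simp: cyl_snoc[OF xs])
      then show ?thesis using lu(2)[OF that(1)] lu(2)[OF that(2)] by simp
    qed
  qed (use ab' S lu sub in \<open>auto intro: less_imp_le\<close>)
  moreover have "h b' - h a' \<le> (d - c) - \<mu> * len xs"
  proof -
    have "\<sigma> * ?G b' - \<sigma> * ?G a' \<le> d - c"
      using \<sigma>[of a' b'] cyl_iter_in[OF xs, of a'] cyl_iter_in[OF xs, of b'] ab' by auto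
    moreover have "\<mu> * len xs = \<mu> * b' - \<mu> * a'" using ab' by (simp add: right_diff_distrib)
    ultimately show ?thesis unfolding h_def by linarith
  qed
  \<comment> \<open>The child contains preimages of both end points of the branch, so by
    monotonicity the return map varies over it by at least \<open>len [s]\<close>.\<close>
  moreover have "len [s] - \<mu> * len (xs @ [s]) \<le> h (u s) - h (l s)" if "s \<in> S" for s
  proof -
    have s': "set [s] \<subseteq> branches" using S that by auto
    obtain v w where vw: "v < w" "cyl [s] = {v..w}" "len [s] = w - v" using s' by (rule cyl_interval)
    have "v \<in> cyl [s]" "w \<in> cyl [s]" using vw by auto
    moreover have "cyl [s] \<subseteq> ?G ` cyl xs" using cyl_props(3)[OF s'] cyl_props(4)[OF xs] by blast
    ultimately have "v \<in> ?G ` cyl xs" "w \<in> ?G ` cyl xs" by blast+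
    then obtain p q where pq: "p \<in> cyl xs" "q \<in> cyl xs" "?G p = v" "?G q = w" by (auto simp del: cyl.simps)
    then have "p \<in> {l s..u s}" "q \<in> {l s..u s}"
      using \<open>v \<in> cyl [s]\<close> \<open>w \<in> cyl [s]\<close> cyl_append[OF xs s'] lu(2)[OF that] by auto
    moreover have "l s \<in> cyl xs" "u s \<in> cyl xs" using sub[OF that] lu(1)[OF that] ab' by auto
    ultimately have "\<bar>w - v\<bar> \<le> \<sigma> * ?G (u s) - \<sigma> * ?G (l s)"
      using \<sigma>[of "l s" p] \<sigma>[of "l s" q] \<sigma>[of p "u s"] \<sigma>[of q "u s"] \<sigma>[of p q] \<sigma>[of q p] pq
      by (cases "p \<le> q") (auto simp: abs_minus_commute)
    moreover have "\<mu> * len (xs @ [s]) = \<mu> * u s - \<mu> * l s" using lu(3)[OF that] by (simp add: right_diff_distrib)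
    ultimately show ?thesis using vw unfolding h_def by linarith
  qed
  then have "(\<Sum>s\<in>S. len [s] - \<mu> * len (xs @ [s])) \<le> (\<Sum>s\<in>S. h (u s) - h (l s))" by (rule sum_mono)
  ultimately have "(\<Sum>s\<in>S. len [s]) - \<mu> * (\<Sum>s\<in>S. len (xs @ [s])) \<le> (d - c) - \<mu> * len xs"
    by (simp add: sum_subtractf sum_distrib_left)
  then have "\<mu> * len xs - \<delta> * (d - c) \<le> \<mu> * (\<Sum>s\<in>S. len (xs @ [s]))" using mass by (simp add: algebra_simps)
  \<comment> \<open>Origin of \<open>C * \<delta>\<close>: the part of \<open>J\<close> missed by
    \<open>S\<close> has length at most \<open>\<delta> * (d - c)\<close>, and dividing by the
    minimal slope \<open>\<mu>\<close> gives \<open>C * \<delta> * len xs\<close>.\<close>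
  moreover have "\<mu> * ((1 - C * \<delta>) * len xs) = \<mu> * len xs - \<delta> * (d - c)"
    using len_pos[OF xs] C by (simp add: \<mu>_def field_simps)
  ultimately have "\<mu> * ((1 - C * \<delta>) * len xs) \<le> \<mu> * (\<Sum>s\<in>S. len (xs @ [s]))" by simp
  then show ?thesis using \<mu> by simp
qed

text \<open>Intermediate value theorem for the displacement, which is nonpositive at a preimage of
  \<open>c\<close> and nonnegative at a preimage of \<open>d\<close>.\<close>

lemma branch_fixed_point:
  assumes s: "s \<in> branches"
  shows "\<exists>p\<in>snd s. (f ^^ fst s) p = p"
proof -
  let ?F = "f ^^ fst s"
  have sub: "snd s \<subseteq> J" using branchD(1)[OF s] .
  obtain x y where xy: "x \<in> snd s" "?F x = c" "y \<in> snd s" "?F y = d"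
    using branchD(3)[OF s] cd by (metis atLeastAtMost_iff imageE less_imp_le order_refl)
  have "connected ((\<lambda>z. ?F z - z) ` snd s)"
    using branchD(2)[OF s] continuous_on_subset[OF continuous_on_iter subset_trans[OF sub J_subset]]
    by (intro connected_continuous_image continuous_on_diff continuous_on_id) auto
  moreover have "?F x - x \<le> 0" "0 \<le> ?F y - y" using xy sub by auto
  ultimately have "0 \<in> (\<lambda>z. ?F z - z) ` snd s"
    using xy by (meson connected_contains_Icc atLeastAtMost_iff imageI subsetD)
  then show ?thesis by auto
qed

end

section \<open>Exponential tails\<close>

text \<open>Local connectedness makes the components relatively open, hence Borel, and by Lindelof
  countable. This allows the bound of H4 on single components to be summed.\<close>

lemma emeasure_relatively_open_components:
  fixes T :: "real set"
  assumes T: "openin (top_of_set {c..d}) T" and Q: "Q \<in> sets lborel"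
  shows "emeasure lborel (T \<inter> Q) = (\<integral>\<^sup>+U. emeasure lborel (U \<inter> Q) \<partial>count_space (components T))"
    and "U \<in> components T \<Longrightarrow> U \<in> sets lborel"
proof -
  have "locally connected {c..d}" by (intro convex_imp_locally_connected) auto
  then have "locally connected T" using T by (rule locally_open_subset)
  then have op: "openin (top_of_set T) U" if "U \<in> components T" for U
    using that by (rule openin_components_locally_connected)
  have Tb: "T \<in> sets borel"
    using T unfolding openin_open by auto
  show sets: "U \<in> sets lborel" if "U \<in> components T" for U
    using op[OF that] Tb unfolding openin_open by auto
  have "countable (components T)"
  proof -
    obtain F where F: "F \<subseteq> components T" "countable F" "\<Union>F = \<Union>(components T)"
      using Lindelof_openin[of "components T" T] op by blast
    have "U \<in> F" if U: "U \<in> components T" for U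
    proof -
      obtain x where "x \<in> U" using in_components_nonempty[OF U] by blast
      then obtain U' where "U' \<in> F" "x \<in> U'" using F(3) U by blast
      then show ?thesis using F(1) U \<open>x \<in> U\<close> components_eq[OF U, of U'] by blast
    qed
    then show ?thesis using F by (metis countable_subset subsetI)
  qed
  moreover have "disjoint_family_on (\<lambda>U. U \<inter> Q) (components T)"
    using components_nonoverlap by (fastforce simp: disjoint_family_on_def)
  ultimately have "emeasure lborel (\<Union>U\<in>components T. U \<inter> Q) = (\<integral>\<^sup>+U. emeasure lborel (U \<inter> Q) \<partial>count_space (components T))"
    using sets Q by (intro emeasure_UN_countable) auto
  moreover have "(\<Union>U\<in>components T. U \<inter> Q) = T \<inter> Q" using Union_components[of T] by blast
  ultimately show "emeasure lborel (T \<inter> Q) = (\<integral>\<^sup>+U. emeasure lborel (U \<inter> Q) \<partial>count_space (components T))" by simp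
qed

context expanding_returns
begin

section \<open>Finitely many branches for each return time, and the sets where \<open>R\<close>
  exceeds \<open>n\<close>\<close>

definition branches_upto :: "nat \<Rightarrow> (nat \<times> real set) set" where
  "branches_upto n = {s \<in> branches. fst s \<le> n}"

lemma branches_upto_subset: "branches_upto n \<subseteq> branches"
  by (auto simp: branches_upto_def)

lemma branches_uptoD: "s \<in> branches_upto n \<Longrightarrow> s \<in> branches"
  by (simp add: branches_upto_def)

lemma compact_branch: "s \<in> branches \<Longrightarrow> compact (snd s)"
  using cyl_props(2)[of "[s]"] cyl_singleton[of s] by simp

lemma sum_len_le:
  assumes "finite S" "S \<subseteq> branches"
  shows "(\<Sum>s\<in>S. len [s]) \<le> d - c"
proof -
  have "\<exists>l u. l < u \<and> snd s = {l..u} \<and> len [s] = u - l" if "s \<in> S" for s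
  proof -
    have s: "set [s] \<subseteq> branches" "s \<in> branches" using assms that by auto
    show ?thesis using cyl_interval[OF s(1)] cyl_singleton[OF s(2)] by metis
  qed
  then obtain l u where lu: "\<And>s. s \<in> S \<Longrightarrow> l s < u s" "\<And>s. s \<in> S \<Longrightarrow> snd s = {l s..u s}"
      "\<And>s. s \<in> S \<Longrightarrow> len [s] = u s - l s" by metis
  have "(\<Sum>s\<in>S. id (u s) - id (l s)) \<le> id d - id c"
  proof (rule sum_increments_le[where h = id and a = c and b = d])
    show "mono_on {c..d} id" by (auto intro: mono_onI)
    show "{l s..u s} \<subseteq> {c..d}" if "s \<in> S" for s
      using branchD(1)[of s] lu(2)[OF that] assms that by auto
    show "{l s..u s} \<inter> {l t..u t} = {}" if "s \<in> S" "t \<in> S" "s \<noteq> t" for s t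
      using branches_disjoint[of s t] lu(2)[OF that(1)] lu(2)[OF that(2)] assms that by auto
  qed (use cd assms lu in \<open>auto intro: less_imp_le\<close>)
  then show ?thesis using lu(3) by simp
qed

text \<open>A component is mapped onto \<open>J\<close>, so by uniform continuity of
  \<open>f ^^ k\<close> its length is bounded below; only finitely many such disjoint intervals fit
  into \<open>J\<close>.\<close>

lemma finite_components_level: "finite (components {x \<in> J. R x = enat k})"
proof (rule ccontr)
  assume inf: "infinite (components {x \<in> J. R x = enat k})"
  obtain \<rho> where \<rho>: "\<rho> > 0" "\<And>x y. x \<in> I \<Longrightarrow> y \<in> I \<Longrightarrow> dist y x < \<rho> \<Longrightarrow> dist ((f ^^ k) y) ((f ^^ k) x) < d - c"
    using compact_uniformly_continuous[OF continuous_on_iter[of k] compact_Icc] cd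
    unfolding uniformly_continuous_on_def by (metis diff_gt_0_iff_gt)
  have len: "\<rho> \<le> len [(k, V)]" if "V \<in> components {x \<in> J. R x = enat k}" for V
  proof -
    have s: "(k, V) \<in> branches" using that by (simp add: branches_def)
    have "c \<in> (f ^^ k) ` V" "d \<in> (f ^^ k) ` V" using branchD(3)[OF s] cd by auto
    then obtain x y where xy: "x \<in> V" "y \<in> V" "(f ^^ k) x = c" "(f ^^ k) y = d" by auto
    then have "x \<in> I" "y \<in> I" using branchD(1)[OF s] J_subset by auto
    then have "\<rho> \<le> \<bar>x - y\<bar>" using \<rho>(2)[of x y] xy cd by (fastforce simp: dist_real_def)
    also have "\<dots> \<le> len [(k, V)]"
      using dist_le_len[of "[(k, V)]" x y] cyl_singleton[OF s] s xy by (simp del: cyl.simps)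
    finally show ?thesis .
  qed
  obtain n where n: "real n * \<rho> > d - c" using reals_Archimedean3[OF \<rho>(1)] by blast
  obtain F where F: "finite F" "card F = n" "F \<subseteq> components {x \<in> J. R x = enat k}"
    using infinite_arbitrarily_large[OF inf] by blast
  have "real n * \<rho> \<le> (\<Sum>V\<in>F. len [(k, V)])"
    using sum_bounded_below[of F \<rho> "\<lambda>V. len [(k, V)]"] len F by auto
  also have "\<dots> = (\<Sum>s\<in>Pair k ` F. len [s])" by (simp add: sum.reindex inj_on_def)
  also have "\<dots> \<le> d - c" using F by (intro sum_len_le) (auto simp: branches_def)
  finally show False using n by simp
qed

lemma finite_branches_upto: "finite (branches_upto n)"
proof (rule finite_subset)
  show "branches_upto n \<subseteq> (SIGMA k:{..n}. components {x \<in> J. R x = enat k})"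
    by (auto simp: branches_upto_def branches_def)
qed (use finite_components_level in auto)

text \<open>Presents a tail set as the complement in \<open>J\<close> of a finite union of compact
  branches: this is the source of its measurability and relative openness.\<close>

lemma return_gt_eq: "{x \<in> J. R x > enat n} = J - (\<Union>s\<in>branches_upto n. snd s)"
proof -
  have "\<not> R x \<le> enat n" if "x \<in> J" "\<forall>s\<in>branches_upto n. x \<notin> snd s" for x
  proof
    assume "R x \<le> enat n"
    then obtain k where k: "R x = enat k" "k \<le> n" by (cases "R x") auto
    then have "x \<in> \<Union>(components {x \<in> J. R x = enat k})"
      unfolding Union_components using that(1) by simp
    then obtain V where "V \<in> components {x \<in> J. R x = enat k}" "x \<in> V" by blast
    then have "(k, V) \<in> branches_upto n" using k by (simp add: branches_upto_def branches_def)
    then show False using that(2) \<open>x \<in> V\<close> by fastforce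
  qed
  moreover have "R x \<le> enat n" if "s \<in> branches_upto n" "x \<in> snd s" for s x
    using branchD(5)[of s x] that by (auto simp: branches_upto_def)
  ultimately show ?thesis by (fastforce simp: not_le)
qed

lemma compact_branches_upto: "compact (\<Union>s\<in>branches_upto n. snd s)"
  by (intro compact_UN finite_branches_upto ballI compact_branch branches_uptoD)

lemma openin_return_gt: "openin (top_of_set J) {x \<in> J. R x > enat n}"
  unfolding return_gt_eq openin_open
  by (rule exI[of _ "- (\<Union>s\<in>branches_upto n. snd s)"])
    (use open_Compl[OF compact_imp_closed[OF compact_branches_upto[of n]]] in \<open>auto simp del: Compl_UN\<close>)

lemma sets_return_gt: "{x \<in> J. R x > enat n} \<in> sets lborel"
  unfolding return_gt_eq using compact_imp_closed[OF compact_branches_upto] by auto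

lemma emeasure_subset_J_finite: "A \<subseteq> J \<Longrightarrow> emeasure lborel A \<noteq> \<infinity>"
  using emeasure_mono[of A J lborel] cd by (auto simp: top_unique)

lemma measure_return_gt: "measure lborel {x \<in> J. R x > enat n} = (d - c) - (\<Sum>s\<in>branches_upto n. len [s])"
proof -
  have sub: "(\<Union>s\<in>branches_upto n. snd s) \<subseteq> J"
    using branchD(1) branches_upto_subset by blast
  have "measure lborel (\<Union>s\<in>branches_upto n. snd s) = (\<Sum>s\<in>branches_upto n. measure lborel (snd s))"
  proof (rule measure_finite_Union)
    show "snd ` branches_upto n \<subseteq> sets lborel"
      using compact_imp_closed[OF compact_branch[OF branches_uptoD]] by (auto simp del: split_paired_All)
    show "disjoint_family_on snd (branches_upto n)"
      using branches_disjoint[OF branches_uptoD branches_uptoD] by (simp add: disjoint_family_on_def)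
    show "emeasure lborel (snd s) \<noteq> \<infinity>" if "s \<in> branches_upto n" for s
      using sub that by (intro emeasure_subset_J_finite) auto
  qed (rule finite_branches_upto)
  also have "\<dots> = (\<Sum>s\<in>branches_upto n. len [s])"
    by (intro sum.cong refl) (simp add: len_def cyl_singleton[OF branches_uptoD] del: cyl.simps)
  finally show ?thesis
    unfolding return_gt_eq using sub compact_imp_closed[OF compact_branches_upto] cd
    by (subst measure_Diff) auto
qed

text \<open>Summed over components, H4 shows that the tail loses the proportion
  \<open>\<gamma>\<close> whenever \<open>n\<close> grows by \<open>l\<^sub>0\<close>, hence decays
  geometrically along a progression. It starts at 1 because H4 concerns
  \<open>n \<ge> 1\<close>.\<close>

lemma measure_return_gt_tendsto_0:
  assumes "cond_H4 J R"
  obtains l\<^sub>0 where "(\<lambda>j. measure lborel {x \<in> J. R x > enat (1 + j * l\<^sub>0)}) \<longlonglongrightarrow> 0" "l\<^sub>0 \<ge> 1"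
proof -
  obtain l\<^sub>0 \<gamma> where l: "l\<^sub>0 \<ge> 1" and \<gamma>: "\<gamma> > 0" and H4: "\<And>n U. n \<ge> 1 \<Longrightarrow> U \<in> components {x \<in> J. R x > enat n} \<Longrightarrow>
      \<gamma> * measure lebesgue U \<le> measure lebesgue {x \<in> U. R x \<le> enat (n + l\<^sub>0)}"
    using assms unfolding cond_H4_def by blast
  define T where "T n = {x \<in> J. R x > enat n}" for n
  have sets: "T n \<in> sets lborel" for n unfolding T_def by (rule sets_return_gt)
  have fin: "A \<subseteq> T n \<Longrightarrow> emeasure lborel A \<noteq> \<infinity>" for A n
    by (rule emeasure_subset_J_finite) (auto simp: T_def)
  have step: "measure lborel (T (n + l\<^sub>0)) \<le> (1 - \<gamma>) * measure lborel (T n)" if "n \<ge> 1" for n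
  proof -
    have op: "openin (top_of_set {c..d}) (T n)" unfolding T_def by (rule openin_return_gt)
    have "ennreal \<gamma> * emeasure lborel (T n) = ennreal \<gamma> * emeasure lborel (T n \<inter> UNIV)" by simp
    also have "\<dots> = (\<integral>\<^sup>+U. ennreal \<gamma> * emeasure lborel U \<partial>count_space (components (T n)))"
      by (subst emeasure_relatively_open_components(1)[OF op]) (auto simp: nn_integral_cmult)
    also have "\<dots> \<le> (\<integral>\<^sup>+U. emeasure lborel (U \<inter> - T (n + l\<^sub>0)) \<partial>count_space (components (T n)))"
    proof (rule nn_integral_mono)
      fix U assume "U \<in> space (count_space (components (T n)))"
      then have U: "U \<in> components (T n)" by simp
      have Us: "U \<in> sets lborel" using emeasure_relatively_open_components(2)[OF op _ U] sets[of n] by blast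
      have sub: "U \<subseteq> T n" using in_components_subset[OF U] .
      have eq: "{x \<in> U. R x \<le> enat (n + l\<^sub>0)} = U \<inter> - T (n + l\<^sub>0)"
        using sub by (auto simp: T_def)
      have "\<gamma> * measure lborel U \<le> measure lborel (U \<inter> - T (n + l\<^sub>0))"
        using H4[OF that, of U] U Us sets[of "n + l\<^sub>0"] unfolding eq T_def[symmetric] by simp
      then have "ennreal (\<gamma> * measure lborel U) \<le> ennreal (measure lborel (U \<inter> - T (n + l\<^sub>0)))"
        by (rule ennreal_leI)
      then show "ennreal \<gamma> * emeasure lborel U \<le> emeasure lborel (U \<inter> - T (n + l\<^sub>0))"
        using fin[of U n] fin[of "U \<inter> - T (n + l\<^sub>0)" n] sub \<gamma>
        by (subst (1 2) emeasure_eq_ennreal_measure) (auto simp: ennreal_mult)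
    qed
    also have "\<dots> = emeasure lborel (T n \<inter> - T (n + l\<^sub>0))"
      using sets[of "n + l\<^sub>0"] by (subst emeasure_relatively_open_components(1)[OF op]) auto
    also have "T n \<inter> - T (n + l\<^sub>0) = T n - T (n + l\<^sub>0)" by auto
    finally have "ennreal (\<gamma> * measure lborel (T n)) \<le> ennreal (measure lborel (T n - T (n + l\<^sub>0)))"
      using fin[of "T n" n] fin[of "T n - T (n + l\<^sub>0)" n] \<gamma>
      by (subst (asm) (1 2) emeasure_eq_ennreal_measure) (auto simp: ennreal_mult)
    then have "\<gamma> * measure lborel (T n) \<le> measure lborel (T n - T (n + l\<^sub>0))"
      by (subst (asm) ennreal_le_iff) auto
    also have "\<dots> = measure lborel (T n) - measure lborel (T (n + l\<^sub>0))"
      using sets fin[of "T n" n] by (intro measure_Diff) (auto simp: T_def order.strict_trans1[rotated])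
    finally show ?thesis by (simp add: algebra_simps)
  qed
  \<comment> \<open>Only \<open>\<gamma> > 0\<close> is known, so \<open>1 - \<gamma>\<close> could
    a priori be negative; the maximum keeps the powers of the ratio nonnegative.\<close>
  define q where "q = max 0 (1 - \<gamma>)"
  have bound: "measure lborel (T (1 + j * l\<^sub>0)) \<le> q ^ j * (d - c)" for j
  proof (induction j)
    case 0
    have "(\<Sum>s\<in>branches_upto 1. len [s]) \<ge> 0"
      by (intro sum_nonneg less_imp_le[OF len_pos]) (simp add: branches_uptoD)
    then show ?case unfolding T_def mult_0 add_0_right measure_return_gt by simp
  next
    case (Suc j)
    have "measure lborel (T (1 + Suc j * l\<^sub>0)) \<le> (1 - \<gamma>) * measure lborel (T (1 + j * l\<^sub>0))"
      using step[of "1 + j * l\<^sub>0"] by (simp add: ac_simps)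
    also have "\<dots> \<le> q * (q ^ j * (d - c))"
      using Suc by (intro mult_mono) (auto simp: q_def)
    finally show ?case by (simp add: mult_ac)
  qed
  have "(\<lambda>j. measure lborel (T (1 + j * l\<^sub>0))) \<longlonglongrightarrow> 0"
  proof (rule tendsto_sandwich[OF _ _ tendsto_const])
    show "(\<lambda>j. q ^ j * (d - c)) \<longlonglongrightarrow> 0"
      using \<gamma> by (intro tendsto_mult_left_zero LIMSEQ_power_zero) (auto simp: q_def)
  qed (use bound in auto)
  then show ?thesis using l that unfolding T_def by blast
qed

text \<open>The lower bound \<open>N\<close> makes room for prescribed branches in the
  alphabet.\<close>

lemma branches_upto_mass:
  assumes "cond_H4 J R" "\<delta> > 0"
  shows "\<exists>n\<ge>N. (1 - \<delta>) * (d - c) \<le> (\<Sum>s\<in>branches_upto n. len [s])"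
proof -
  obtain l\<^sub>0 where l: "(\<lambda>j. measure lborel {x \<in> J. R x > enat (1 + j * l\<^sub>0)}) \<longlonglongrightarrow> 0" "l\<^sub>0 \<ge> 1"
    using measure_return_gt_tendsto_0[OF assms(1)] by blast
  have "\<forall>\<^sub>F j in sequentially. measure lborel {x \<in> J. R x > enat (1 + j * l\<^sub>0)} < \<delta> * (d - c)"
    using l(1) by (rule order_tendstoD) (use cd assms in auto)
  then have "\<forall>\<^sub>F j in sequentially. N \<le> j \<and> measure lborel {x \<in> J. R x > enat (1 + j * l\<^sub>0)} < \<delta> * (d - c)"
    using eventually_ge_at_top[of N] by (rule eventually_conj[rotated])
  then obtain j where j: "N \<le> j" "measure lborel {x \<in> J. R x > enat (1 + j * l\<^sub>0)} < \<delta> * (d - c)"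
    using eventually_happens'[OF sequentially_bot] by blast
  have "j * 1 \<le> j * l\<^sub>0" using l(2) by (rule mult_le_mono2)
  then have "N \<le> 1 + j * l\<^sub>0" using j(1) by linarith
  then show ?thesis
    using j(2) unfolding measure_return_gt by (intro exI[of _ "1 + j * l\<^sub>0"]) (auto simp: algebra_simps)
qed

text \<open>Finitely many branches would form a closed set of full measure, hence all of
  \<open>J\<close>. As they are disjoint and closed, connectedness leaves a single branch equal to
  \<open>J\<close>, which contradicts expansion.\<close>

lemma infinite_branches:
  assumes "cond_H4 J R"
  shows "infinite branches"
proof
  assume fin: "finite branches"
  define N where "N = Max (fst ` branches)"
  have upto: "branches_upto n = branches" if "n \<ge> N" for n
  proof -
    have "fst s \<le> n" if "s \<in> branches" for s
      using Max_ge[OF finite_imageI[OF fin] imageI[OF that], of fst] \<open>n \<ge> N\<close> unfolding N_def by linarith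
    then show ?thesis by (auto simp: branches_upto_def)
  qed
  define K where "K = (\<Union>s\<in>branches. snd s)"
  have clK: "closed K" using compact_imp_closed[OF compact_branches_upto[of N]] upto[of N] by (simp add: K_def)
  have "d - c \<le> (\<Sum>s\<in>branches. len [s])"
  proof (rule field_le_epsilon)
    fix e :: real assume "e > 0"
    then obtain n where "n \<ge> N" "(1 - e / (d - c)) * (d - c) \<le> (\<Sum>s\<in>branches_upto n. len [s])"
      using branches_upto_mass[OF assms, of "e / (d - c)" N] cd by auto
    moreover have "(1 - e / (d - c)) * (d - c) = d - c - e" using cd by (simp add: left_diff_distrib)
    ultimately show "d - c \<le> (\<Sum>s\<in>branches. len [s]) + e" using upto[of n] by simp
  qed
  then have "measure lborel (J - K) \<le> 0"
    using measure_return_gt[of N] unfolding return_gt_eq upto[of N, simplified] K_def by simp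
  then have "measure lborel (J - K) = 0" by (simp add: measure_le_0_iff)
  then have "emeasure lborel (J - K) = 0"
    using emeasure_eq_ennreal_measure[of lborel "J - K"] emeasure_subset_J_finite[of "J - K"] by simp
  moreover have "{c<..<d} - K \<subseteq> J - K" by auto
  ultimately have "emeasure lborel ({c<..<d} - K) = 0"
    using emeasure_mono[of "{c<..<d} - K" "J - K" lborel] clK by auto
  then have "negligible ({c<..<d} - K)"
    using clK unfolding negligible_iff_null_sets by (intro null_sets_completionI) auto
  then have "{c<..<d} - K = {}"
    using open_not_negligible[of "{c<..<d} - K"] clK by (auto simp: open_Diff)
  \<comment> \<open>The open null set argument reaches interior points only; the end points follow
    by closure.\<close>
  then have "closure {c<..<d} \<subseteq> K" using clK by (intro closure_minimal) auto
  then have JK: "J \<subseteq> K" using cd by simp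
  then obtain s where s: "s \<in> branches" using cd unfolding K_def by fastforce
  have "snd s \<inter> J = {} \<or> (\<Union>t\<in>branches - {s}. snd t) \<inter> J = {}"
  proof (rule connected_closedD)
    show "snd s \<inter> (\<Union>t\<in>branches - {s}. snd t) \<inter> J = {}" using branches_disjoint[OF s] by fastforce
    show "J \<subseteq> snd s \<union> (\<Union>t\<in>branches - {s}. snd t)" using JK by (auto simp: K_def)
    show "closed (snd s)" "closed (\<Union>t\<in>branches - {s}. snd t)"
      using fin s compact_imp_closed[OF compact_branch] by (auto intro!: closed_UN)
  qed simp
  moreover have "snd s \<noteq> {}" "snd s \<subseteq> J" using branchD(1,3)[OF s] cd by auto
  ultimately have "J \<subseteq> snd s" using JK by (auto simp: K_def)
  then have "c \<in> cyl [s]" "d \<in> cyl [s]" using cd cyl_singleton[OF s] by (auto simp del: cyl.simps)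
  then have "\<bar>c - d\<bar> \<le> (d - c) / \<Lambda> ^ length [s]" using s by (intro cyl_diam_le) auto
  moreover have "(d - c) / \<Lambda> < d - c" using cd \<Lambda> by (simp add: divide_less_eq)
  ultimately show False using cd by simp
qed

end

section \<open>Long runs of a prescribed branch\<close>

definition run :: "nat \<Rightarrow> nat \<Rightarrow> nat set" where
  "run q k = {q ^ Suc k..<q ^ Suc k + q ^ k}"

text \<open>A run ends before twice its starting position, and the next one starts at
  \<open>q\<close> times that position.\<close>

lemma run_unique:
  assumes "j \<in> run q k" "j \<in> run q k'" "q \<ge> 2"
  shows "k = k'"
proof -
  have False if "j \<in> run q k" "j \<in> run q k'" "k < k'" for k k'
  proof -
    have "q ^ Suc (Suc k) \<le> q ^ Suc k'" using that(3) assms(3) by (intro power_increasing) auto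
    moreover have "q ^ k \<le> q ^ Suc k" using assms(3) by (intro power_increasing) auto
    moreover have "2 * q ^ Suc k \<le> q ^ Suc (Suc k)" using assms(3) by simp
    ultimately show False using that(1,2) unfolding run_def atLeastLessThan_iff by linarith
  qed
  then show ?thesis using assms(1,2) by (metis linorder_neqE_nat)
qed

text \<open>Before \<open>n\<close> only runs starting below \<open>n\<close> count, and their
  lengths form a geometric sum dominated by the last. The density of forced positions is thus at
  most \<open>2 / q\<close>.\<close>

lemma card_runs_le:
  assumes "q \<ge> 2"
  shows "q * card {j. j < n \<and> (\<exists>k. j \<in> run q k)} \<le> 2 * n"
proof (cases "n = 0")
  case False
  then obtain K where K: "q ^ K \<le> n" "n < q ^ Suc K"
    using ex_power_ivl1[OF assms, of n] by auto
  have "{j. j < n \<and> (\<exists>k. j \<in> run q k)} \<subseteq> (\<Union>k<K. run q k)"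
  proof clarify
    fix j k assume "j < n" and j: "j \<in> run q k"
    then have "q ^ Suc k < q ^ Suc K" using K(2) by (auto simp: run_def simp del: power_Suc)
    then have "Suc k < Suc K" using assms by (subst (asm) power_strict_increasing_iff) auto
    then have "k < K" by simp
    then show "j \<in> (\<Union>k<K. run q k)" using j by auto
  qed
  then have "card {j. j < n \<and> (\<exists>k. j \<in> run q k)} \<le> card (\<Union>k<K. run q k)"
    by (intro card_mono) (auto simp: run_def)
  also have "\<dots> \<le> (\<Sum>k<K. card (run q k))" by (intro card_UN_le) auto
  finally have "q * card {j. j < n \<and> (\<exists>k. j \<in> run q k)} \<le> (\<Sum>k<K. q ^ Suc k)"
    by (simp add: run_def sum_distrib_left[symmetric])
  also have "\<dots> \<le> 2 * q ^ K"
  proof (induction K)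
    case (Suc K)
    have "2 * q ^ K \<le> q ^ Suc K" using assms by simp
    then show ?case using Suc unfolding sum.lessThan_Suc by linarith
  qed simp
  finally show ?thesis using K(1) by linarith
qed simp

lemma sum_orbit_blocks:
  fixes f :: "'a \<Rightarrow> 'a" and \<phi> :: "'a \<Rightarrow> real"
  shows "(\<Sum>i<a + n * r. \<phi> ((f ^^ i) x)) =
    (\<Sum>i<a. \<phi> ((f ^^ i) x)) + (\<Sum>j<n. \<Sum>i<r. \<phi> ((f ^^ i) ((f ^^ (a + j * r)) x)))"
proof -
  have block: "(\<Sum>i<k + r. \<phi> ((f ^^ i) x)) = (\<Sum>i<k. \<phi> ((f ^^ i) x)) + (\<Sum>i<r. \<phi> ((f ^^ i) ((f ^^ k) x)))" for k
    by (induction r) (simp_all add: add.commute[of k] funpow_add)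
  show ?thesis
  proof (induction n)
    case (Suc n)
    have "a + Suc n * r = (a + n * r) + r" by simp
    then show ?case using Suc block[of "a + n * r"] by (simp only: sum.lessThan_Suc add.assoc)
  qed simp
qed

context expanding_returns
begin

section \<open>Birkhoff averages along long runs\<close>

lemma time_ge_length: "set xs \<subseteq> branches \<Longrightarrow> length xs \<le> time xs"
proof (induction xs)
  case (Cons s xs)
  then show ?case using branchD(6)[of s] by simp
qed simp

lemma time_le: "(\<And>s. s \<in> set xs \<Longrightarrow> fst s \<le> n) \<Longrightarrow> time xs \<le> n * length xs"
proof (induction xs)
  case (Cons s xs)
  have "time xs \<le> n * length xs" "fst s \<le> n" using Cons by auto
  then show ?case by simp
qed simp

lemma time_replicate: "time (replicate n s) = n * fst s"
  by (simp add: sum_list_replicate)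

lemma set_replicate_branches: "s \<in> branches \<Longrightarrow> set (replicate n s) \<subseteq> branches"
  by auto

lemma fixed_point_in_cyl:
  assumes "s \<in> branches" "p \<in> snd s" "(f ^^ fst s) p = p"
  shows "p \<in> cyl (replicate n s)"
  using assms branchD(1)[OF assms(1)] by (induction n) auto

lemma iter_in_cyl_replicate:
  assumes s: "s \<in> branches" and y: "y \<in> cyl (replicate n s)" and "j \<le> n"
  shows "(f ^^ (j * fst s)) y \<in> cyl (replicate (n - j) s)"
proof -
  have "replicate n s = replicate j s @ replicate (n - j) s"
    using \<open>j \<le> n\<close> by (metis le_add_diff_inverse replicate_add)
  then have "y \<in> cyl (replicate j s @ replicate (n - j) s)" using y by simp
  then show ?thesis
    unfolding cyl_append[OF set_replicate_branches[OF s] set_replicate_branches[OF s]] time_replicate by simp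
qed

text \<open>During a run of \<open>n\<close> digits \<open>s\<close> the orbit shadows the periodic orbit of the fixed point of
  the branch \<open>s\<close>; since the run takes a fixed proportion of the time elapsed so far, the limit of the
  Birkhoff averages, if it exists, is the average over that periodic orbit.\<close>

lemma average_eq_of_long_runs:
  assumes s: "s \<in> branches" and p: "p \<in> snd s" "(f ^^ fst s) p = p"
    and \<phi>: "continuous_on I \<phi>"
    and lim: "(\<lambda>n. (\<Sum>i<n. \<phi> ((f ^^ i) x)) / real n) \<longlonglongrightarrow> \<alpha>"
    and runs: "\<And>N. \<exists>n\<ge>N. \<exists>t. n \<le> t \<and> t \<le> M * n \<and> (f ^^ t) x \<in> cyl (replicate n s)"
  shows "(\<Sum>i<fst s. \<phi> ((f ^^ i) p)) = real (fst s) * \<alpha>"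
proof -
  define r where "r = fst s"
  define h where "h y = (\<Sum>i<r. \<phi> ((f ^^ i) y))" for y
  define S where "S n = (\<Sum>i<n. \<phi> ((f ^^ i) x))" for n
  define \<beta> where "\<beta> = real r * \<alpha>"
  have pJ: "p \<in> J" using p(1) branchD(1)[OF s] by blast
  then have pI: "p \<in> I" using J_subset by blast
  have h: "continuous_on I h"
    unfolding h_def using iter_into
    by (intro continuous_on_sum continuous_on_compose2[OF \<phi> continuous_on_iter]) auto
  obtain H where "\<forall>y\<in>I. \<bar>h y\<bar> \<le> H"
    using compact_imp_bounded[OF compact_continuous_image[OF h compact_Icc]] by (auto simp: bounded_iff)
  then have H: "\<bar>h y\<bar> \<le> H" if "y \<in> I" for y using that by blast
  have H0: "H \<ge> 0" using H[OF pI] by simp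
  have bound: "\<bar>h p - \<beta>\<bar> \<le> \<tau> * (2 + 2 * real M + real r)" if \<tau>: "\<tau> > 0" for \<tau>
  proof -
    obtain \<rho> where \<rho>: "\<rho> > 0" "\<And>y. y \<in> I \<Longrightarrow> dist y p < \<rho> \<Longrightarrow> dist (h y) (h p) < \<tau>"
      using h pI \<tau> unfolding continuous_on_iff by metis
    have "(\<lambda>j. (d - c) * (1 / \<Lambda>) ^ j) \<longlonglongrightarrow> 0"
      using \<Lambda> by (intro tendsto_mult_right_zero LIMSEQ_power_zero) auto
    then have "\<forall>\<^sub>F j in sequentially. (d - c) * (1 / \<Lambda>) ^ j < \<rho>"
      using \<rho>(1) by (rule order_tendstoD)
    then obtain m where m: "\<And>j. j \<ge> m \<Longrightarrow> (d - c) * (1 / \<Lambda>) ^ j < \<rho>"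
      unfolding eventually_sequentially by blast
    have close: "\<bar>h y - h p\<bar> \<le> \<tau>" if "y \<in> cyl (replicate j s)" "j \<ge> m" for y j
    proof -
      have "\<bar>y - p\<bar> \<le> (d - c) / \<Lambda> ^ length (replicate j s)"
        using that fixed_point_in_cyl[OF s p] set_replicate_branches[OF s] by (intro cyl_diam_le)
      then have "dist y p < \<rho>" using m[OF that(2)] by (simp add: dist_real_def power_one_over)
      moreover have "y \<in> I" using that cyl_subset_I[OF set_replicate_branches[OF s]] by blast
      ultimately show ?thesis using \<rho>(2)[of y] by (simp add: dist_real_def)
    qed
    have "\<forall>\<^sub>F n in sequentially. dist (S n / real n) \<alpha> < \<tau>"
      using lim \<tau> unfolding S_def by (rule tendstoD)
    then obtain N where N: "\<And>n. n \<ge> N \<Longrightarrow> dist (S n / real n) \<alpha> < \<tau>"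
      unfolding eventually_sequentially by blast
    have S: "\<bar>S n - real n * \<alpha>\<bar> \<le> \<tau> * real n" if "n \<ge> N" "n > 0" for n
    proof -
      have "S n - real n * \<alpha> = (S n / real n - \<alpha>) * real n"
        using that(2) by (simp add: field_simps)
      then have "\<bar>S n - real n * \<alpha>\<bar> = \<bar>S n / real n - \<alpha>\<bar> * real n" by (simp add: abs_mult)
      also have "\<dots> \<le> \<tau> * real n" using N[OF that(1)] by (intro mult_right_mono) (auto simp: dist_real_def)
      finally show ?thesis .
    qed
    \<comment> \<open>For \<open>n \<ge> N'\<close> the at most \<open>m\<close> uncontrolled blocks
      contribute no more than \<open>n * \<tau>\<close> in total.\<close>
    obtain N' where N': "2 * H * real m < real N' * \<tau>" using reals_Archimedean3[OF \<tau>] by blast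
    obtain n t where nt: "n \<ge> Suc (N + m + N')" "n \<le> t" "t \<le> M * n" "(f ^^ t) x \<in> cyl (replicate n s)"
      using runs[of "Suc (N + m + N')"] by blast
    define y where "y j = (f ^^ (t + j * r)) x" for j
    have y: "y j \<in> cyl (replicate (n - j) s)" if "j \<le> n" for j
      using iter_in_cyl_replicate[OF s nt(4) that]
      by (simp add: y_def r_def add.commute[of t] funpow_add)
    have "\<bar>(\<Sum>j<n. h (y j)) - real n * h p\<bar> = \<bar>\<Sum>j<n. h (y j) - h p\<bar>"
      by (simp add: sum_subtractf)
    also have "\<dots> \<le> (\<Sum>j<n. \<bar>h (y j) - h p\<bar>)" by (rule sum_abs)
    \<comment> \<open>With at least \<open>m\<close> digits of the run left, the orbit is close to
      \<open>p\<close>; in the last \<open>m\<close> blocks only the bound \<open>H\<close> on the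
      block sums is available.\<close>
    also have "\<dots> \<le> (\<Sum>j<n. \<tau> + (if j \<in> {n - m..<n} then 2 * H else 0))"
    proof (rule sum_mono)
      fix j assume j: "j \<in> {..<n}"
      show "\<bar>h (y j) - h p\<bar> \<le> \<tau> + (if j \<in> {n - m..<n} then 2 * H else 0)"
      proof (cases "j < n - m")
        case True
        then show ?thesis using close[OF y[of j]] j by auto
      next
        case False
        have "y j \<in> I"
          by (rule subsetD[OF cyl_subset_I[OF set_replicate_branches[OF s]] y]) (use j in simp)
        then show ?thesis using False j H[of "y j"] H[OF pI] \<tau> by auto
      qed
    qed
    also have "\<dots> = real n * \<tau> + real (card ({..<n} \<inter> {n - m..<n})) * (2 * H)"
      by (simp add: sum.distrib sum.inter_restrict[symmetric] del: atLeastLessThan_iff)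
    also have "{..<n} \<inter> {n - m..<n} = {n - m..<n}" by auto
    also have "real (card {n - m..<n}) * (2 * H) \<le> real n * \<tau>"
    proof -
      have "real (card {n - m..<n}) * (2 * H) \<le> 2 * H * real m" using nt(1) by simp
      also have "\<dots> \<le> real N' * \<tau>" using N' by simp
      also have "\<dots> \<le> real n * \<tau>" using nt(1) \<tau> by (intro mult_right_mono) auto
      finally show ?thesis .
    qed
    finally have 1: "\<bar>(\<Sum>j<n. h (y j)) - real n * h p\<bar> \<le> 2 * (real n * \<tau>)" by (simp add: mult.commute)
    have t: "N \<le> t" "0 < t" using nt(1,2) by linarith+
    have "(\<Sum>j<n. h (y j)) = S (t + n * r) - S t"
      unfolding S_def sum_orbit_blocks h_def y_def by simp
    moreover have "\<bar>S (t + n * r) - real (t + n * r) * \<alpha>\<bar> \<le> \<tau> * real (t + n * r)" "\<bar>S t - real t * \<alpha>\<bar> \<le> \<tau> * real t"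
      using S[of t] S[of "t + n * r"] t by (simp_all add: trans_le_add1 del: of_nat_add)
    moreover have "real (t + n * r) * \<alpha> - real t * \<alpha> = real n * \<beta>" by (simp add: \<beta>_def algebra_simps)
    ultimately have "\<bar>(\<Sum>j<n. h (y j)) - real n * \<beta>\<bar> \<le> \<tau> * real (t + n * r) + \<tau> * real t" by linarith
    also have "\<dots> = \<tau> * (2 * real t + real n * real r)" by (simp add: algebra_simps)
    \<comment> \<open>Here the proportion enters: \<open>t \<le> M * n\<close> makes the error at
      time \<open>t\<close> comparable with \<open>n\<close>, so it survives division by
      \<open>n\<close>.\<close>
    also have "\<dots> \<le> \<tau> * (2 * (real M * real n) + real n * real r)"
      using nt(3) \<tau> by (intro mult_left_mono add_right_mono) (auto simp flip: of_nat_mult)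
    finally have "\<bar>real n * h p - real n * \<beta>\<bar> \<le> real n * (\<tau> * (2 + 2 * real M + real r))"
      using 1 by (simp add: algebra_simps)
    then have "real n * \<bar>h p - \<beta>\<bar> \<le> real n * (\<tau> * (2 + 2 * real M + real r))"
      by (simp add: abs_mult flip: right_diff_distrib)
    then show ?thesis using nt(1) by simp
  qed
  have "\<bar>h p - \<beta>\<bar> \<le> 0"
  proof (rule field_le_epsilon)
    fix e :: real assume "e > 0"
    then show "\<bar>h p - \<beta>\<bar> \<le> 0 + e"
      using bound[of "e / (2 + 2 * real M + real r)"] by (simp add: add_pos_nonneg)
  qed
  then show ?thesis by (simp add: h_def \<beta>_def r_def)
qed

text \<open>Distinct branches are disjoint, so their fixed points are distinct. There are infinitely
  many of them, more than one finite orbit can contain.\<close>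

lemma branches_disjoint_periodic_orbits:
  assumes "infinite branches"
  obtains u v p q where "u \<in> branches" "p \<in> snd u" "(f ^^ fst u) p = p"
    "v \<in> branches" "q \<in> snd v" "(f ^^ fst v) q = q" "q \<notin> (\<lambda>i. (f ^^ i) p) ` {..<fst u}"
proof -
  obtain P where P: "\<And>s. s \<in> branches \<Longrightarrow> P s \<in> snd s \<and> (f ^^ fst s) (P s) = P s"
    using branch_fixed_point by metis
  obtain u where u: "u \<in> branches" using assms by (metis ex_in_conv finite.emptyI)
  have "inj_on P branches"
  proof (rule inj_onI, rule ccontr)
    fix s t assume "s \<in> branches" "t \<in> branches" "P s = P t" "s \<noteq> t"
    then show False using branches_disjoint[of s t] P[of s] P[of t] by auto
  qed
  then have "infinite (P ` branches)" using assms finite_image_iff by blast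
  then have "infinite (P ` branches - (\<lambda>i. (f ^^ i) (P u)) ` {..<fst u})" by simp
  then have "P ` branches - (\<lambda>i. (f ^^ i) (P u)) ` {..<fst u} \<noteq> {}" by (metis finite.emptyI)
  then obtain v where v: "v \<in> branches" "P v \<notin> (\<lambda>i. (f ^^ i) (P u)) ` {..<fst u}" by blast
  show ?thesis using that[OF u _ _ v(1) _ _ v(2)] P[OF u] P[OF v(1)] by blast
qed

end

section \<open>The set of irregular points\<close>

context expanding_returns
begin

text \<open>A word read up to the end of run k is a prefix of \<open>q * n\<close> digits followed
  by \<open>n = q ^ k\<close> copies of \<open>w\<close>. Each digit takes between 1 and
  \<open>B\<close> units of time, which gives both bounds on \<open>t\<close>.\<close>

lemma tree_limit_long_runs:
  assumes x: "x \<in> tree_limit cyl A"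
    and S: "\<And>j. A j \<subseteq> S" "S \<subseteq> branches" and B: "\<And>s. s \<in> S \<Longrightarrow> fst s \<le> B"
    and q: "q \<ge> 2" and forced: "\<And>N. \<exists>k\<ge>N. \<forall>j\<in>run q k. A j = {w}"
  shows "\<exists>n\<ge>N. \<exists>t. n \<le> t \<and> t \<le> B * q * n \<and> (f ^^ t) x \<in> cyl (replicate n w)"
proof -
  obtain k where k: "k \<ge> N" "\<And>j. j \<in> run q k \<Longrightarrow> A j = {w}" using forced by blast
  define n where "n = q ^ k"
  have n: "n \<ge> N" using power_gt_expt[of q k] q k(1) by (simp add: n_def)
  obtain zs where zs: "zs \<in> words A (q ^ Suc k + n)" "x \<in> cyl zs" using x by (rule tree_limitE)
  obtain xs ys where xy: "zs = xs @ ys" "xs \<in> words A (q ^ Suc k)" "length ys = n" "\<forall>j<n. ys ! j \<in> A (q ^ Suc k + j)"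
    using zs(1) by (rule words_append)
  have "ys ! j = w" if "j < n" for j
  proof -
    have "ys ! j \<in> A (q ^ Suc k + j)" using xy(4) that by blast
    moreover have "A (q ^ Suc k + j) = {w}" using k(2) that by (simp add: run_def n_def)
    ultimately show ?thesis by simp
  qed
  then have ys: "ys = replicate n w" using xy(3) by (intro nth_equalityI) auto
  have xsS: "set xs \<subseteq> S" and xsl: "length xs = q * n"
    using words_subset[OF xy(2) S(1)] xy(2) by (auto simp: words_def n_def)
  have ysS: "set ys \<subseteq> S" using words_subset[OF zs(1) S(1)] unfolding xy(1) by simp
  have "(f ^^ time xs) x \<in> cyl ys"
    using zs(2) cyl_append[of xs ys] xsS ysS S(2) unfolding xy(1) by auto
  moreover have "length xs \<le> time xs" using xsS S(2) by (intro time_ge_length) auto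
  then have "n \<le> time xs" using xsl mult_le_mono1[of 1 q n] q by linarith
  moreover have "time xs \<le> B * length xs" using xsS B by (intro time_le) auto
  ultimately show ?thesis
    using n xsl unfolding ys by (intro exI[of _ n] exI[of _ "time xs"] conjI) (auto simp: mult_ac)
qed

lemma tree_limit_not_quasi_regular:
  assumes x: "x \<in> tree_limit cyl A"
    and S: "\<And>j. A j \<subseteq> S" "S \<subseteq> branches" "finite S"
    and q: "q \<ge> 2"
    and u: "u \<in> branches" "p \<in> snd u" "(f ^^ fst u) p = p" "\<And>N. \<exists>k\<ge>N. \<forall>j\<in>run q k. A j = {u}"
    and v: "v \<in> branches" "p' \<in> snd v" "(f ^^ fst v) p' = p'" "\<And>N. \<exists>k\<ge>N. \<forall>j\<in>run q k. A j = {v}"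
    and orbits: "p' \<notin> (\<lambda>i. (f ^^ i) p) ` {..<fst u}"
  shows "x \<in> I - quasi_regular I f"
proof -
  have "x \<in> J" using tree_limitE[OF x, of 0] by auto
  then have xI: "x \<in> I" using J_subset by blast
  define Orb where "Orb = (\<lambda>i. (f ^^ i) p) ` {..<fst u}"
  \<comment> \<open>The distance to the orbit of \<open>p\<close> has average 0 along that orbit,
    while its average over the orbit of \<open>p'\<close> is positive since it is nonnegative and
    \<open>p'\<close> lies outside the closed set \<open>Orb\<close>. One limit cannot match
    both.\<close>
  define \<phi> where "\<phi> y = infdist y Orb" for y
  have Orb: "closed Orb" "Orb \<noteq> {}"
    using branchD(6)[OF u(1)] by (auto simp: Orb_def lessThan_empty_iff intro!: finite_imp_closed)
  have \<phi>: "continuous_on I \<phi>" unfolding \<phi>_def by (intro continuous_intros)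
  have "x \<notin> quasi_regular I f"
  proof
    assume "x \<in> quasi_regular I f"
    then obtain \<mu> where "weak_star_converges I (\<lambda>n. empirical_measure I f n x) \<mu>"
      by (auto simp: quasi_regular_def)
    then have "(\<lambda>n. \<integral>y. \<phi> y \<partial>empirical_measure I f n x) \<longlonglongrightarrow> (\<integral>y. \<phi> y \<partial>\<mu>)"
      using \<phi> by (simp add: weak_star_converges_def)
    then have lim: "(\<lambda>n. (\<Sum>i<n. \<phi> ((f ^^ i) x)) / real n) \<longlonglongrightarrow> (\<integral>y. \<phi> y \<partial>\<mu>)" (is "_ \<longlonglongrightarrow> ?\<alpha>")
      unfolding integral_empirical_measure[OF f_into xI \<phi>] .
    obtain B where "\<forall>s\<in>S. fst s \<le> B"
      using finite_nat_set_iff_bounded_le[of "fst ` S"] S(3) by auto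
    then have B: "\<And>s. s \<in> S \<Longrightarrow> fst s \<le> B" by blast
    note runs = tree_limit_long_runs[OF x S(1,2) B q]
    have "(\<Sum>i<fst u. \<phi> ((f ^^ i) p)) = real (fst u) * ?\<alpha>"
      using runs[OF _ u(4)] by (intro average_eq_of_long_runs[OF u(1-3) \<phi> lim, of "B * q"]) blast
    moreover have "(\<Sum>i<fst u. \<phi> ((f ^^ i) p)) = 0"
      by (intro sum.neutral) (auto simp: \<phi>_def Orb_def)
    ultimately have "?\<alpha> = 0" using branchD(6)[OF u(1)] by simp
    moreover have "(\<Sum>i<fst v. \<phi> ((f ^^ i) p')) = real (fst v) * ?\<alpha>"
      using runs[OF _ v(4)] by (intro average_eq_of_long_runs[OF v(1-3) \<phi> lim, of "B * q"]) blast
    ultimately have "(\<Sum>i<fst v. \<phi> ((f ^^ i) p')) = 0" by simp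
    then have "\<forall>i\<in>{..<fst v}. \<phi> ((f ^^ i) p') = 0"
      by (subst (asm) sum_nonneg_eq_0_iff) (auto simp: \<phi>_def infdist_nonneg)
    then have "\<phi> ((f ^^ 0) p') = 0" using branchD(6)[OF v(1)] by fastforce
    then show False
      using infdist_pos_not_in_closed[OF Orb, of p'] orbits by (simp add: \<phi>_def Orb_def)
  qed
  then show ?thesis using xI by blast
qed

text \<open>Finitely many disjoint compact sets have pairwise positive distances.\<close>

lemma branches_gap:
  assumes "finite S" "S \<subseteq> branches"
  obtains \<kappa> where "\<kappa> > 0" "\<And>s t v w. s \<in> S \<Longrightarrow> t \<in> S \<Longrightarrow> s \<noteq> t \<Longrightarrow> v \<in> snd s \<Longrightarrow> w \<in> snd t \<Longrightarrow> \<kappa> \<le> \<bar>v - w\<bar>"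
proof
  define P where "P = {(s, t) \<in> S \<times> S. s \<noteq> t}"
  define \<kappa> where "\<kappa> = Min (insert 1 ((\<lambda>(s, t). setdist (snd s) (snd t)) ` P))"
  have fin: "finite P" using assms(1) by (auto simp: P_def intro: finite_subset[of _ "S \<times> S"])
  have "0 < setdist (snd s) (snd t)" if "(s, t) \<in> P" for s t
  proof -
    have st: "s \<in> branches" "t \<in> branches" "s \<noteq> t" using that assms by (auto simp: P_def)
    have "snd s \<noteq> {}" "snd t \<noteq> {}" using branchD(3)[OF st(1)] branchD(3)[OF st(2)] cd by auto
    then show ?thesis
      using branches_disjoint[OF st] compact_branch[OF st(1)] compact_imp_closed[OF compact_branch[OF st(2)]]
      by (simp add: setdist_gt_0_compact_closed)
  qed
  then show "\<kappa> > 0" using fin unfolding \<kappa>_def by (subst Min_gr_iff) auto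
  fix s t v w assume *: "s \<in> S" "t \<in> S" "s \<noteq> t" "v \<in> snd s" "w \<in> snd t"
  then have "(s, t) \<in> P" by (simp add: P_def)
  then have "\<kappa> \<le> setdist (snd s) (snd t)"
    using fin unfolding \<kappa>_def by (intro Min_le) (auto intro!: rev_image_eqI)
  also have "\<dots> \<le> dist v w" using *(4,5) by (rule setdist_le_dist)
  finally show "\<kappa> \<le> \<bar>v - w\<bar>" by (simp add: dist_real_def)
qed

lemma irregular_content:
  assumes H4: "cond_H4 J R" and s: "0 < s" "s < 1"
  shows "\<exists>c>0. \<forall>z r. (\<forall>i::nat. 0 < r i) \<longrightarrow> I - quasi_regular I f \<subseteq> (\<Union>i. ball (z i) (r i)) \<longrightarrow>
      (\<exists>T. finite T \<and> c \<le> (\<Sum>i\<in>T. r i powr s))"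
proof -
  obtain u v p p' where u: "u \<in> branches" "p \<in> snd u" "(f ^^ fst u) p = p"
    and v: "v \<in> branches" "p' \<in> snd v" "(f ^^ fst v) p' = p'"
    and orbits: "p' \<notin> (\<lambda>i. (f ^^ i) p) ` {..<fst u}"
    using infinite_branches[OF H4] by (rule branches_disjoint_periodic_orbits)
  \<comment> \<open>The loss allowed per level is
    \<open>\<Lambda> powr (1 - s) = \<theta> ^ 2\<close>: one factor \<open>\<theta>\<close> for the
    level itself, the other to save up for forced positions.\<close>
  define \<theta> where "\<theta> = \<Lambda> powr ((1 - s) / 2)"
  have \<theta>: "\<theta> > 1" using \<Lambda> s by (simp add: \<theta>_def)
  \<comment> \<open>Chosen such that \<open>1 - C * \<delta> = 1 / \<theta>\<close>, the loss at a
    free position.\<close>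
  define \<delta> where "\<delta> = (1 - 1 / \<theta>) / C"
  have \<delta>: "\<delta> > 0" using \<theta> C by (simp add: \<delta>_def)
  obtain n where n: "max (fst u) (fst v) \<le> n" "(1 - \<delta>) * (d - c) \<le> (\<Sum>s\<in>branches_upto n. len [s])"
    using branches_upto_mass[OF H4 \<delta>] by blast
  define S where "S = branches_upto n"
  have S: "finite S" "S \<subseteq> branches" "u \<in> S" "v \<in> S"
    using finite_branches_upto branches_upto_subset u v n by (auto simp: S_def branches_upto_def)
  \<comment> \<open>The proportion that a cylinder keeps, at the least, at a forced
    position.\<close>
  define \<epsilon> where "\<epsilon> = min (len [u]) (len [v]) / (C * (d - c))"
  have \<epsilon>: "\<epsilon> > 0" using u v C cd len_pos[of "[u]"] len_pos[of "[v]"] by (simp add: \<epsilon>_def)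
  \<comment> \<open>A forced position is paid for by \<open>Q\<close> additional factors
    \<open>\<theta>\<close>.\<close>
  obtain Q where Q: "1 / \<epsilon> < \<theta> ^ Q" using real_arch_pow[OF \<theta>] by blast
  \<comment> \<open>At most \<open>2 * m / q = m / (Q + 1)\<close> of the first \<open>m\<close>
    positions are forced, so the additional factors number at most \<open>m\<close> and
    \<open>K m \<le> \<theta> ^ (2 * m)\<close>.\<close>
  define q where "q = 2 * (Q + 1)"
  have q: "q \<ge> 2" by (simp add: q_def)
  \<comment> \<open>Runs are disjoint, so giving even runs precedence cannot overwrite an odd
    one.\<close>
  define A where "A j = (if \<exists>k. even k \<and> j \<in> run q k then {u} else if \<exists>k. j \<in> run q k then {v} else S)" for j
  define N where "N n = card {j. j < n \<and> (\<exists>k. j \<in> run q k)}" for n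
  define K where "K n = \<theta> ^ (n + Q * N n)" for n
  have A_sub: "A j \<subseteq> S" for j using S by (simp add: A_def)
  have A_fin: "finite (A j)" for j using finite_subset[OF A_sub S(1)] .
  have words_br: "set xs \<subseteq> branches" "length xs = m" if "xs \<in> words A m" for xs m
    using words_subset[OF that A_sub] that S(2) by (auto simp: words_def)
  have A_br: "w \<in> branches" if "w \<in> A j" for w j using that A_sub S(2) by blast
  have A_u: "\<exists>k\<ge>M. \<forall>j\<in>run q k. A j = {u}" for M
    by (rule exI[of _ "2 * M"]) (auto simp: A_def)
  have A_v: "\<exists>k\<ge>M. \<forall>j\<in>run q k. A j = {v}" for M
  proof (intro exI conjI ballI)
    fix j assume j: "j \<in> run q (2 * M + 1)"
    have "odd k" if "j \<in> run q k" for k using run_unique[OF that j q] by simp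
    then show "A j = {v}" using j by (auto simp: A_def)
  qed simp
  have N_Suc: "N (Suc m) = N m + (if \<exists>k. m \<in> run q k then 1 else 0)" for m
  proof -
    have "{j. j < Suc m \<and> (\<exists>k. j \<in> run q k)} =
        {j. j < m \<and> (\<exists>k. j \<in> run q k)} \<union> (if \<exists>k. m \<in> run q k then {m} else {})"
      by (auto simp: less_Suc_eq)
    then show ?thesis unfolding N_def by (simp add: card_insert_if)
  qed
  have mass: "K m * len xs \<le> K (Suc m) * (\<Sum>w\<in>A m. len (xs @ [w]))" if xs: "xs \<in> words A m" for m xs
  proof (cases "\<exists>k. m \<in> run q k")
    case True
    then have "A m = {u} \<or> A m = {v}" by (simp add: A_def)
    then obtain w where w: "A m = {w}" "w = u \<or> w = v" by blast
    have "\<epsilon> * len xs \<le> len [w] / (C * (d - c)) * len xs"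
      using w(2) C cd len_pos[OF words_br(1)[OF xs]]
      unfolding \<epsilon>_def by (intro mult_right_mono divide_right_mono) auto
    also have "\<dots> \<le> len (xs @ [w])"
      using w(2) u(1) v(1) by (intro child_len_ge[OF words_br(1)[OF xs]]) auto
    finally have "\<epsilon> * len xs \<le> len (xs @ [w])" .
    moreover have "1 \<le> \<theta> ^ Suc Q * \<epsilon>"
    proof -
      have "1 \<le> \<theta> ^ Q * \<epsilon>" using Q \<epsilon> by (simp add: field_simps)
      also have "\<dots> \<le> \<theta> * (\<theta> ^ Q * \<epsilon>)" using \<theta> \<epsilon> mult_right_mono[of 1 \<theta> "\<theta> ^ Q * \<epsilon>"] by simp
      finally show ?thesis by (simp add: mult_ac)
    qed
    ultimately have "1 * len xs \<le> \<theta> ^ Suc Q * \<epsilon> * len xs" "\<theta> ^ Suc Q * (\<epsilon> * len xs) \<le> \<theta> ^ Suc Q * len (xs @ [w])"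
      using len_pos[OF words_br(1)[OF xs]] \<theta> by (intro mult_right_mono mult_left_mono; simp)+
    then have "len xs \<le> \<theta> ^ Suc Q * len (xs @ [w])" by (simp only: mult.assoc mult_1)
    then have "K m * len xs \<le> K m * (\<theta> ^ Suc Q * len (xs @ [w]))"
      using \<theta> by (intro mult_left_mono) (auto simp: K_def)
    also have "\<dots> = K (Suc m) * (\<Sum>w\<in>A m. len (xs @ [w]))"
      using True by (simp add: K_def N_Suc w(1) power_add mult_ac)
    finally show ?thesis .
  next
    case False
    then have Am: "A m = S" by (auto simp: A_def)
    have "(1 - C * \<delta>) * len xs \<le> (\<Sum>w\<in>S. len (xs @ [w]))"
      using sum_children_len_ge[OF words_br(1)[OF xs] S(1,2)] n(2) by (simp add: S_def)
    moreover have "1 - C * \<delta> = 1 / \<theta>" using C by (simp add: \<delta>_def)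
    ultimately have "len xs \<le> \<theta> * (\<Sum>w\<in>S. len (xs @ [w]))" using \<theta> by (simp add: field_simps)
    then have "K m * len xs \<le> K m * (\<theta> * (\<Sum>w\<in>S. len (xs @ [w])))"
      using \<theta> by (intro mult_left_mono) (auto simp: K_def)
    also have "\<dots> = K (Suc m) * (\<Sum>w\<in>A m. len (xs @ [w]))"
      using False by (simp add: K_def N_Suc Am power_add mult_ac)
    finally show ?thesis .
  qed
  have K_le: "K m \<le> \<Lambda> powr ((1 - s) * real m)" for m
  proof -
    have "q * N m \<le> 2 * m" unfolding N_def by (rule card_runs_le[OF q])
    then have "Q * N m \<le> m" by (simp add: q_def)
    then have "K m \<le> \<theta> ^ (2 * m)" unfolding K_def using \<theta> by (intro power_increasing) auto
    also have "\<theta> ^ (2 * m) = \<Lambda> powr ((1 - s) * real m)"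
      using \<Lambda> by (simp add: \<theta>_def powr_realpow[symmetric] powr_powr)
    finally show ?thesis .
  qed
  obtain \<kappa> where \<kappa>: "\<kappa> > 0" "\<And>s t v w. s \<in> S \<Longrightarrow> t \<in> S \<Longrightarrow> s \<noteq> t \<Longrightarrow> v \<in> snd s \<Longrightarrow> w \<in> snd t \<Longrightarrow> \<kappa> \<le> \<bar>v - w\<bar>"
    using branches_gap[OF S(1,2)] by blast
  obtain c' where c': "c' > 0"
    "\<And>z r. (\<And>i::nat. 0 < r i) \<Longrightarrow> tree_limit cyl A \<subseteq> (\<Union>i. ball (z i) (r i)) \<Longrightarrow>
      \<exists>T. finite T \<and> c' \<le> (\<Sum>i\<in>T. r i powr s)"
  proof (rule tree_limit_content[of A cyl len "d - c" \<Lambda> "\<kappa> / (C * (d - c))" K s])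
    show "cyl xs \<noteq> {}" if "xs \<in> words A m" for m xs
      using cyl_props(4)[OF words_br(1)[OF that]] cd by auto
    show "cyl (xs @ [w]) \<subseteq> cyl xs" if "xs \<in> words A m" "w \<in> A m" for m xs w
      using cyl_snoc[OF words_br(1)[OF that(1)] A_br[OF that(2)]] by blast
    show "len xs \<le> (d - c) / \<Lambda> ^ m" if "xs \<in> words A m" for m xs
      using len_le[OF words_br(1)[OF that]] words_br(2)[OF that] by simp
    show "\<kappa> / (C * (d - c)) * len xs \<le> \<bar>x - y\<bar>"
      if "xs \<in> words A m" "w \<in> A m" "t \<in> A m" "w \<noteq> t" "x \<in> cyl (xs @ [w])" "y \<in> cyl (xs @ [t])" for m xs w t x y
      using that A_sub \<kappa>(2)[of w t]
      by (intro children_gap[OF words_br(1)[OF that(1)] A_br[OF that(2)] A_br[OF that(3)] _ that(5,6)]) blast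
    show "compact (cyl xs)" if "xs \<in> words A m" for m xs using cyl_props(2)[OF words_br(1)[OF that]] .
    show "0 < len xs" if "xs \<in> words A m" for m xs using len_pos[OF words_br(1)[OF that]] .
    show "0 \<le> K m" for m using \<theta> by (simp add: K_def)
    show "0 < K 0" using \<theta> by (simp add: K_def)
    show "0 < \<kappa> / (C * (d - c))" using \<kappa> C cd by simp
  qed (use A_fin mass K_le \<Lambda> cd s in auto)
  have "tree_limit cyl A \<subseteq> I - quasi_regular I f"
    using tree_limit_not_quasi_regular[OF _ A_sub S(2,1) q u A_u v A_v orbits] by blast
  then show ?thesis using c' by (meson subset_trans)
qed

end

theorem theorem5:
  fixes a b c d :: real
    and I J :: "real set"
    and f :: "real \<Rightarrow> real"
    and R :: "real \<Rightarrow> enat"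
  assumes "a < b" and "I = {a..b}"
    and "f ` I \<subseteq> I"
    and "C2_on I f"
    and "topologically_mixing_on I f"
    and "c < d" and "J = {c..d}" and "J \<subseteq> I"
    and "return_time_function f J R"
    and "cond_H1 I f J R"
    and "cond_H2 f J R"
    and "cond_H3 I f J R"
    and "cond_H4 J R"
  shows "hausdorff_dim (I - quasi_regular I f) = 1"
proof -
  have I: "I = {a..b}" and J: "J = {c..d}" by fact+
  obtain \<Lambda> where \<Lambda>: "\<Lambda> > 1" and H1: "\<forall>n\<ge>1. \<forall>V \<in> components {x \<in> J. R x = enat n}.
      (f ^^ n) ` V = J \<and> (\<forall>x\<in>V. \<bar>iter_deriv I f n x\<bar> \<ge> \<Lambda>)"
    using \<open>cond_H1 I f J R\<close> unfolding cond_H1_def by (elim exE conjE) (rule that)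
  obtain C \<eta> where C: "C \<ge> 1" and H3: "\<forall>n\<ge>1. \<forall>ks. return_composition n ks \<longrightarrow>
      (\<forall>B \<in> components (return_cylinder f J R ks). \<forall>y\<in>B. \<forall>z\<in>B.
        \<bar>iter_deriv I f n y\<bar> / \<bar>iter_deriv I f n z\<bar> \<le> C \<and>
        \<bar>iter_deriv I f (hd ks) y\<bar> / \<bar>iter_deriv I f (hd ks) z\<bar> \<le> exp (\<eta> (length ks)))"
    using \<open>cond_H3 I f J R\<close> unfolding cond_H3_def by (elim exE conjE) (rule that)
  have pos: "sum_list ks \<ge> 1" if "return_composition (sum_list ks) ks" for ks
    using that by (cases ks) (auto simp: return_composition_def)
  interpret expanding_returns a b c d f R \<Lambda> C
  proof
    show "f differentiable (at x within {a..b})" if "x \<in> {a..b}" for x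
      using \<open>C2_on I f\<close> that unfolding C2_on_def I by (auto simp: real_differentiable_def)
    show "R x \<noteq> 0" if "x \<in> {c..d}" for x
      using \<open>return_time_function f J R\<close> that unfolding return_time_function_def J by blast
    show "(f ^^ n) ` V = {c..d}" "\<And>x. x \<in> V \<Longrightarrow> \<Lambda> \<le> \<bar>iter_deriv {a..b} f n x\<bar>"
      if "n \<ge> 1" "V \<in> components {x \<in> {c..d}. R x = enat n}" for n V
      using H1[rule_format, OF that[folded J]] unfolding I J by blast+
    show "\<bar>iter_deriv {a..b} f (sum_list ks) y\<bar> / \<bar>iter_deriv {a..b} f (sum_list ks) z\<bar> \<le> C"
      if "return_composition (sum_list ks) ks" "B \<in> components (return_cylinder f {c..d} R ks)" "y \<in> B" "z \<in> B"
      for ks B y z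
      using H3[rule_format, OF pos[OF that(1)] that(1) that(2)[folded J] that(3,4)] unfolding I by blast
  qed (use assms \<Lambda> C in auto)
  show ?thesis
  proof (rule antisym)
    show "hausdorff_dim (I - quasi_regular I f) \<le> 1"
      using \<open>a < b\<close> unfolding I by (intro hausdorff_dim_le_1[of _ a b]) auto
    show "1 \<le> hausdorff_dim (I - quasi_regular I f)"
      using irregular_content[OF \<open>cond_H4 J R\<close>[unfolded J]] unfolding I by (intro hausdorff_dim_ge_1)
  qed
qed

end
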